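(* (1) Every language definable by a tree in $\mathrm{ADT}_0$ is definable both by a $\Sigma_2$-sentence and by a $\Pi_2$-sentence of first-order logic over words; that is, $\mathrm{ADT}_0\subseteq\Sigma_2\cap\Pi_2$. Moreover equivalent sentences can be effectively computed from the tree. (2) For every $k>0$, every language definable by a tree in $\mathrm{ADT}_k$ is definable by a $\Sigma_{k+1}$-sentence; that is, $\mathrm{ADT}_k\subseteq\Sigma_{k+1}$. Moreover an equivalent sentence can be effectively computed from the tree.
   Context: Fix a finite set $\mathrm{Prop}$ of propositions (with $\top := p\lor\neg p$ for $p\in\mathrm{Prop}$, and $\bot:=\neg\top$) and let the alphabet be $A = 2^{\mathrm{Prop}}$ (valuations). A trace is a word in $A^*$; $\varepsilon$ is the empty trace. The set $\mathrm{ADT}$ of attack-defense trees is defined inductively: the special leaf $\epsilon$ and every propositional formula $\gamma$ over $\mathrm{Prop}$ are in $\mathrm{ADT}$; if $\theta_1,\dots,\theta_n\in\mathrm{ADT}$ then $\mathrm{OR}(\theta_1,\dots,\theta_n)$, $\mathrm{SAND}(\theta_1,\dots,\theta_n)$, $\mathrm{AND}(\theta_1,\dots,\theta_n)\in\mathrm{ADT}$; if $\theta,\theta'\in\mathrm{ADT}$ then $\mathrm{C}(\theta,\theta')\in\mathrm{ADT}$. Semantics $[\![\theta]\!]\subseteq A^*$: $[\![\epsilon]\!]=\{\varepsilon\}$; $[\![\gamma]\!]=\{v_1\cdots v_n\in A^* : n\ge 1,\ v_n\models\gamma\}$; $\mathrm{OR}$ is interpreted as union, $\mathrm{SAND}$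 as concatenation (in the given order), $[\![\mathrm{C}(\theta_1,\theta_2)]\!]=[\![\theta_1]\!]\setminus[\![\theta_2]\!]$, and $[\![\mathrm{AND}(\theta_1,\dots,\theta_n)]\!]=\bigcup_{i}\big([\![\theta_i]\!]\cap\bigcap_{j\ne i}[\![\theta_j]\!]\cdot A^*\big)$. Countermeasure-depth: $\mathrm{cd}(\epsilon)=\mathrm{cd}(\gamma)=0$; $\mathrm{cd}(\mathrm{OP}(\theta_1,\dots,\theta_n))=\max_i\mathrm{cd}(\theta_i)$ for $\mathrm{OP}\in\{\mathrm{OR},\mathrm{SAND},\mathrm{AND}\}$; $\mathrm{cd}(\mathrm{C}(\theta_1,\theta_2))=\max\{\mathrm{cd}(\theta_1),\mathrm{cd}(\theta_2)+1\}$. $\mathrm{ADT}_k=\{\theta\in\mathrm{ADT}:\mathrm{cd}(\theta)\le k\}$. Inclusions between classes of trees and classes of formulas refer to the classes of languages over $A$ they define. First-order logic over words on $A$ has a unary predicate $a(x)$ for each $a\in A$ ("the letter at position $x$ is $a$") and the binary predicate $x<y$ on positions; the empty word is an allowed model (empty domain). $\Sigma_\ell$ (resp. $\Pi_\ell$) is the set of formulas with at most $\ell$ alternating blocks of quantifiers, starting with $\exists$ (resp. $\forall$). As a convention accommodating the empty word, these are not required to be prenex: $\Sigma_0=\Pi_0$ are the quantifier-free formulas, $\Sigma_\ell$ is the closure of $\Sigma_{\ell-1}\cup\Pi_{\ell-1}$ under $\land,\lor,\exists$, and $\Pi_\ell$ is the closure of $\Sigma_{\ell-1}\cup\Pi_{\ell-1}$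 under $\land,\lor,\forall$. *)

theory Defs
  imports Main "HOL-Library.Countable" "HOL-Library.Nat_Bijection"
begin

text \<open>The finite set of propositions is the (nonempty) finite type \<open>'p\<close>; a letter is the
  valuation given by the set of propositions that it makes true.\<close>

type_synonym 'p letter = "'p set"
type_synonym 'p trace = "'p letter list"

datatype 'p pform =
    PAtom 'p
  | PNot "'p pform"
  | PAnd "'p pform" "'p pform"
  | POr "'p pform" "'p pform"

primrec pmodels :: "'p letter \<Rightarrow> 'p pform \<Rightarrow> bool" where
  "pmodels v (PAtom p) \<longleftrightarrow> p \<in> v"
| "pmodels v (PNot \<gamma>) \<longleftrightarrow> \<not> pmodels v \<gamma>"
| "pmodels v (PAnd \<gamma> \<delta>) \<longleftrightarrow> pmodels v \<gamma> \<and> pmodels v \<delta>"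
| "pmodels v (POr \<gamma> \<delta>) \<longleftrightarrow> pmodels v \<gamma> \<or> pmodels v \<delta>"

datatype 'p adt =
    Eps
  | Leaf "'p pform"
  | OR "'p adt list"
  | SAND "'p adt list"
  | AND "'p adt list"
  | C "'p adt" "'p adt"

text \<open>The operators OR, SAND and AND take at least one argument.\<close>

primrec wf_adt :: "'p adt \<Rightarrow> bool" where
  "wf_adt Eps \<longleftrightarrow> True"
| "wf_adt (Leaf \<gamma>) \<longleftrightarrow> True"
| "wf_adt (OR ts) \<longleftrightarrow> ts \<noteq> [] \<and> list_all wf_adt ts"
| "wf_adt (SAND ts) \<longleftrightarrow> ts \<noteq> [] \<and> list_all wf_adt ts"
| "wf_adt (AND ts) \<longleftrightarrow> ts \<noteq> [] \<and> list_all wf_adt ts"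
| "wf_adt (C t u) \<longleftrightarrow> wf_adt t \<and> wf_adt u"

definition conc :: "'a list set \<Rightarrow> 'a list set \<Rightarrow> 'a list set" where
  "conc L M = {u @ v | u v. u \<in> L \<and> v \<in> M}"

definition and_lang :: "'a list set list \<Rightarrow> 'a list set" where
  "and_lang Ls =
     (\<Union>i<length Ls. Ls ! i \<inter> (\<Inter>j\<in>{..<length Ls} - {i}. conc (Ls ! j) UNIV))"

primrec sem :: "'p adt \<Rightarrow> 'p trace set" where
  "sem Eps = {[]}"
| "sem (Leaf \<gamma>) = {w. w \<noteq> [] \<and> pmodels (last w) \<gamma>}"
| "sem (OR ts) = \<Union> (set (map sem ts))"
| "sem (SAND ts) = foldr conc (map sem ts) {[]}"
| "sem (AND ts) = and_lang (map sem ts)"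
| "sem (C t u) = sem t - sem u"

primrec cd :: "'p adt \<Rightarrow> nat" where
  "cd Eps = 0"
| "cd (Leaf \<gamma>) = 0"
| "cd (OR ts) = Max (set (map cd ts))"
| "cd (SAND ts) = Max (set (map cd ts))"
| "cd (AND ts) = Max (set (map cd ts))"
| "cd (C t u) = max (cd t) (cd u + 1)"

definition ADT :: "nat \<Rightarrow> 'p adt set" where
  "ADT k = {\<theta>. wf_adt \<theta> \<and> cd \<theta> \<le> k}"

definition ADT_langs :: "nat \<Rightarrow> 'p trace set set" where
  "ADT_langs k = sem ` ADT k"

text \<open>Equality of positions is not primitive: it is the quantifier-free formula stating that
  neither position is smaller than the other.\<close>

datatype 'p fo =
    Letter "'p letter" nat
  | Less nat nat
  | Neg "'p fo"
  | Conj "'p fo" "'p fo"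
  | Disj "'p fo" "'p fo"
  | Exi nat "'p fo"
  | Uni nat "'p fo"

text \<open>Positions are \<open>0, \<dots>, length w - 1\<close>; quantifiers range over these only, so the domain of
  the empty word is empty.\<close>

primrec sat :: "'p trace \<Rightarrow> (nat \<Rightarrow> nat) \<Rightarrow> 'p fo \<Rightarrow> bool" where
  "sat w \<sigma> (Letter a x) \<longleftrightarrow> w ! \<sigma> x = a"
| "sat w \<sigma> (Less x y) \<longleftrightarrow> \<sigma> x < \<sigma> y"
| "sat w \<sigma> (Neg \<phi>) \<longleftrightarrow> \<not> sat w \<sigma> \<phi>"
| "sat w \<sigma> (Conj \<phi> \<psi>) \<longleftrightarrow> sat w \<sigma> \<phi> \<and> sat w \<sigma> \<psi>"
| "sat w \<sigma> (Disj \<phi> \<psi>) \<longleftrightarrow> sat w \<sigma> \<phi> \<or> sat w \<sigma> \<psi>"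
| "sat w \<sigma> (Exi x \<phi>) \<longleftrightarrow> (\<exists>i<length w. sat w (\<sigma>(x := i)) \<phi>)"
| "sat w \<sigma> (Uni x \<phi>) \<longleftrightarrow> (\<forall>i<length w. sat w (\<sigma>(x := i)) \<phi>)"

primrec free_vars :: "'p fo \<Rightarrow> nat set" where
  "free_vars (Letter a x) = {x}"
| "free_vars (Less x y) = {x, y}"
| "free_vars (Neg \<phi>) = free_vars \<phi>"
| "free_vars (Conj \<phi> \<psi>) = free_vars \<phi> \<union> free_vars \<psi>"
| "free_vars (Disj \<phi> \<psi>) = free_vars \<phi> \<union> free_vars \<psi>"
| "free_vars (Exi x \<phi>) = free_vars \<phi> - {x}"
| "free_vars (Uni x \<phi>) = free_vars \<phi> - {x}"

definition sentence :: "'p fo \<Rightarrow> bool" where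
  "sentence \<phi> \<longleftrightarrow> free_vars \<phi> = {}"

text \<open>Only used for sentences, whose truth does not depend on the assignment.\<close>

definition lang :: "'p fo \<Rightarrow> 'p trace set" where
  "lang \<phi> = {w. sat w (\<lambda>_. 0) \<phi>}"

lemma sat_cong:
  "(\<And>x. x \<in> free_vars \<phi> \<Longrightarrow> \<sigma> x = \<tau> x) \<Longrightarrow> sat w \<sigma> \<phi> \<longleftrightarrow> sat w \<tau> \<phi>"
proof (induction \<phi> arbitrary: \<sigma> \<tau>)
  case (Exi x \<phi>)
  have "sat w (\<sigma>(x := i)) \<phi> \<longleftrightarrow> sat w (\<tau>(x := i)) \<phi>" for i
    by (rule Exi.IH) (use Exi.prems in auto)
  then show ?case by simp
next
  case (Uni x \<phi>)
  have "sat w (\<sigma>(x := i)) \<phi> \<longleftrightarrow> sat w (\<tau>(x := i)) \<phi>" for i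
    by (rule Uni.IH) (use Uni.prems in auto)
  then show ?case by simp
next
  case (Neg \<phi>)
  then show ?case by (metis free_vars.simps(3) sat.simps(3))
next
  case (Conj \<phi> \<psi>)
  then show ?case by (metis UnCI free_vars.simps(4) sat.simps(4))
next
  case (Disj \<phi> \<psi>)
  then show ?case by (metis UnCI free_vars.simps(5) sat.simps(5))
qed auto

lemma lang_sentence: "sentence \<phi> \<Longrightarrow> w \<in> lang \<phi> \<longleftrightarrow> sat w \<sigma> \<phi>"
  unfolding lang_def sentence_def mem_Collect_eq by (rule sat_cong) simp

primrec quantifier_free :: "'p fo \<Rightarrow> bool" where
  "quantifier_free (Letter a x) \<longleftrightarrow> True"
| "quantifier_free (Less x y) \<longleftrightarrow> True"
| "quantifier_free (Neg \<phi>) \<longleftrightarrow> quantifier_free \<phi>"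
| "quantifier_free (Conj \<phi> \<psi>) \<longleftrightarrow> quantifier_free \<phi> \<and> quantifier_free \<psi>"
| "quantifier_free (Disj \<phi> \<psi>) \<longleftrightarrow> quantifier_free \<phi> \<and> quantifier_free \<psi>"
| "quantifier_free (Exi x \<phi>) \<longleftrightarrow> False"
| "quantifier_free (Uni x \<phi>) \<longleftrightarrow> False"

inductive Sigma_fo :: "nat \<Rightarrow> 'p fo \<Rightarrow> bool" and Pi_fo :: "nat \<Rightarrow> 'p fo \<Rightarrow> bool" where
  Sigma_zero: "quantifier_free \<phi> \<Longrightarrow> Sigma_fo 0 \<phi>"
| Sigma_from_Sigma: "Sigma_fo l \<phi> \<Longrightarrow> Sigma_fo (Suc l) \<phi>"
| Sigma_from_Pi: "Pi_fo l \<phi> \<Longrightarrow> Sigma_fo (Suc l) \<phi>"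
| Sigma_Conj: "Sigma_fo (Suc l) \<phi> \<Longrightarrow> Sigma_fo (Suc l) \<psi> \<Longrightarrow> Sigma_fo (Suc l) (Conj \<phi> \<psi>)"
| Sigma_Disj: "Sigma_fo (Suc l) \<phi> \<Longrightarrow> Sigma_fo (Suc l) \<psi> \<Longrightarrow> Sigma_fo (Suc l) (Disj \<phi> \<psi>)"
| Sigma_Exi: "Sigma_fo (Suc l) \<phi> \<Longrightarrow> Sigma_fo (Suc l) (Exi x \<phi>)"
| Pi_zero: "quantifier_free \<phi> \<Longrightarrow> Pi_fo 0 \<phi>"
| Pi_from_Sigma: "Sigma_fo l \<phi> \<Longrightarrow> Pi_fo (Suc l) \<phi>"
| Pi_from_Pi: "Pi_fo l \<phi> \<Longrightarrow> Pi_fo (Suc l) \<phi>"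
| Pi_Conj: "Pi_fo (Suc l) \<phi> \<Longrightarrow> Pi_fo (Suc l) \<psi> \<Longrightarrow> Pi_fo (Suc l) (Conj \<phi> \<psi>)"
| Pi_Disj: "Pi_fo (Suc l) \<phi> \<Longrightarrow> Pi_fo (Suc l) \<psi> \<Longrightarrow> Pi_fo (Suc l) (Disj \<phi> \<psi>)"
| Pi_Uni: "Pi_fo (Suc l) \<phi> \<Longrightarrow> Pi_fo (Suc l) (Uni x \<phi>)"

definition Sigma_sentences :: "nat \<Rightarrow> 'p fo set" where
  "Sigma_sentences l = {\<phi>. sentence \<phi> \<and> Sigma_fo l \<phi>}"

definition Pi_sentences :: "nat \<Rightarrow> 'p fo set" where
  "Pi_sentences l = {\<phi>. sentence \<phi> \<and> Pi_fo l \<phi>}"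

definition Sigma_langs :: "nat \<Rightarrow> 'p trace set set" where
  "Sigma_langs l = lang ` Sigma_sentences l"

definition Pi_langs :: "nat \<Rightarrow> 'p trace set set" where
  "Pi_langs l = lang ` Pi_sentences l"

text \<open>\<open>recursive n f\<close>: the restriction of \<open>f\<close> to argument lists of length \<open>n\<close> is a (total)
  \<open>n\<close>-ary general recursive function, i.e. it is built from the initial functions by
  composition, primitive recursion on the first argument, and minimization of regular
  functions. By Kleene's normal form theorem these are exactly the total Turing-computable
  functions. Values on lists of other lengths are irrelevant.\<close>

inductive recursive :: "nat \<Rightarrow> (nat list \<Rightarrow> nat) \<Rightarrow> bool" where
  rec_zero: "recursive n (\<lambda>xs. 0)"
| rec_succ: "recursive 1 (\<lambda>xs. Suc (xs ! 0))"
| rec_proj: "i < n \<Longrightarrow> recursive n (\<lambda>xs. xs ! i)"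
| rec_comp: "recursive (length fs) g \<Longrightarrow> \<forall>f\<in>set fs. recursive n f
    \<Longrightarrow> recursive n (\<lambda>xs. g (map (\<lambda>f. f xs) fs))"
| rec_prim: "recursive n f \<Longrightarrow> recursive (n + 2) g
    \<Longrightarrow> recursive (n + 1) (\<lambda>xs. rec_nat (f (tl xs)) (\<lambda>y r. g (y # r # tl xs)) (hd xs))"
| rec_min: "recursive (n + 1) f \<Longrightarrow> \<forall>xs. length xs = n \<longrightarrow> (\<exists>y. f (y # xs) = 0)
    \<Longrightarrow> recursive n (\<lambda>xs. LEAST y. f (y # xs) = 0)"

text \<open>Goedel numberings of the syntax. The type \<open>'p\<close> is finite, so the numbering \<open>to_nat\<close> of
  the propositions is a finite table, and the notion of computability below does not depend on
  which injection is chosen.\<close>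

primrec code_pform :: "'p::finite pform \<Rightarrow> nat" where
  "code_pform (PAtom p) = prod_encode (0, to_nat p)"
| "code_pform (PNot \<gamma>) = prod_encode (1, code_pform \<gamma>)"
| "code_pform (PAnd \<gamma> \<delta>) = prod_encode (2, prod_encode (code_pform \<gamma>, code_pform \<delta>))"
| "code_pform (POr \<gamma> \<delta>) = prod_encode (3, prod_encode (code_pform \<gamma>, code_pform \<delta>))"

primrec code_adt :: "'p::finite adt \<Rightarrow> nat" where
  "code_adt Eps = prod_encode (0, 0)"
| "code_adt (Leaf \<gamma>) = prod_encode (1, code_pform \<gamma>)"
| "code_adt (OR ts) = prod_encode (2, list_encode (map code_adt ts))"
| "code_adt (SAND ts) = prod_encode (3, list_encode (map code_adt ts))"
| "code_adt (AND ts) = prod_encode (4, list_encode (map code_adt ts))"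
| "code_adt (C t u) = prod_encode (5, prod_encode (code_adt t, code_adt u))"

definition code_letter :: "'p::finite letter \<Rightarrow> nat" where
  "code_letter a = set_encode (to_nat ` a)"

primrec code_fo :: "'p::finite fo \<Rightarrow> nat" where
  "code_fo (Letter a x) = prod_encode (0, prod_encode (code_letter a, x))"
| "code_fo (Less x y) = prod_encode (1, prod_encode (x, y))"
| "code_fo (Neg \<phi>) = prod_encode (2, code_fo \<phi>)"
| "code_fo (Conj \<phi> \<psi>) = prod_encode (3, prod_encode (code_fo \<phi>, code_fo \<psi>))"
| "code_fo (Disj \<phi> \<psi>) = prod_encode (4, prod_encode (code_fo \<phi>, code_fo \<psi>))"
| "code_fo (Exi x \<phi>) = prod_encode (5, prod_encode (x, code_fo \<phi>))"
| "code_fo (Uni x \<phi>) = prod_encode (6, prod_encode (x, code_fo \<phi>))"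

lemma code_pform_inject: "code_pform \<gamma> = code_pform \<delta> \<longleftrightarrow> \<gamma> = \<delta>"
proof (induction \<gamma> arbitrary: \<delta>)
  case (PAtom p) then show ?case by (cases \<delta>) auto
next
  case (PNot \<gamma>) then show ?case by (cases \<delta>) auto
next
  case (PAnd \<gamma>1 \<gamma>2) then show ?case by (cases \<delta>) auto
next
  case (POr \<gamma>1 \<gamma>2) then show ?case by (cases \<delta>) auto
qed

lemma code_adt_inject: "code_adt t = code_adt u \<Longrightarrow> t = u"
proof (induction t arbitrary: u)
  case Eps then show ?case by (cases u) simp_all
next
  case (Leaf \<gamma>) then show ?case by (cases u) (simp_all add: code_pform_inject)
next
  case (OR ts)
  from OR.prems obtain us where us: "u = OR us" and eq: "map code_adt ts = map code_adt us"
    by (cases u) (simp_all add: list_encode_eq)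
  from OR.IH eq have "ts = us" by (rule list.inj_map_strong)
  with us show ?case by simp
next
  case (SAND ts)
  from SAND.prems obtain us where us: "u = SAND us" and eq: "map code_adt ts = map code_adt us"
    by (cases u) (simp_all add: list_encode_eq)
  from SAND.IH eq have "ts = us" by (rule list.inj_map_strong)
  with us show ?case by simp
next
  case (AND ts)
  from AND.prems obtain us where us: "u = AND us" and eq: "map code_adt ts = map code_adt us"
    by (cases u) (simp_all add: list_encode_eq)
  from AND.IH eq have "ts = us" by (rule list.inj_map_strong)
  with us show ?case by simp
next
  case (C t1 t2)
  from C.prems show ?case by (cases u) (auto dest: C.IH)
qed

lemma code_letter_inject: "code_letter a = code_letter b \<longleftrightarrow> a = b"
proof
  assume "code_letter a = code_letter b"
  then have "set_encode (to_nat ` a) = set_encode (to_nat ` b)"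
    by (simp only: code_letter_def)
  then have "to_nat ` a = to_nat ` b"
    by (rule inj_onD[OF inj_on_set_encode]) (simp_all add: finite_imageI)
  then show "a = b" by (simp only: inj_image_eq_iff[OF inj_to_nat])
qed simp

lemma code_fo_inject: "code_fo \<phi> = code_fo \<psi> \<longleftrightarrow> \<phi> = \<psi>"
proof (induction \<phi> arbitrary: \<psi>)
  case (Letter a x) then show ?case by (cases \<psi>) (auto simp: code_letter_inject)
next
  case (Less x y) then show ?case by (cases \<psi>) auto
next
  case (Neg \<phi>) then show ?case by (cases \<psi>) auto
next
  case (Conj \<phi>1 \<phi>2) then show ?case by (cases \<psi>) auto
next
  case (Disj \<phi>1 \<phi>2) then show ?case by (cases \<psi>) auto
next
  case (Exi x \<phi>) then show ?case by (cases \<psi>) auto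
next
  case (Uni x \<phi>) then show ?case by (cases \<psi>) auto
qed

definition effective :: "('p::finite adt \<Rightarrow> 'p fo) \<Rightarrow> bool" where
  "effective F \<longleftrightarrow>
     (\<exists>g. recursive 1 g \<and> (\<forall>\<theta>. wf_adt \<theta> \<longrightarrow> g [code_adt \<theta>] = code_fo (F \<theta>)))"

end

theory Submission
  imports Defs
begin

text \<open>A factor of a word is delimited by the position before it and its last position, so that
  the leaf \<open>\<gamma>\<close> is quantifier-free: only the last letter is inspected. Concatenation, also
  with \<open>A\<^sup>*\<close> in AND, only needs existential quantifiers for the cut, hence a tree of depth 0
  becomes \<open>\<Sigma>\<^sub>1\<close> relative to the last position, and each countermeasure adds one
  level by negation. Being the last position is a \<open>\<Pi>\<^sub>1\<close> condition \<open>last y\<close>, so both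
  \<open>\<exists>y. last y \<and> \<phi> y\<close> and \<open>\<forall>y. \<not> last y \<or> \<phi> y\<close> are available, giving \<open>\<Sigma>\<^sub>2\<close>
  and \<open>\<Pi>\<^sub>2\<close> at depth 0; the empty word is treated separately. Three variables
  suffice, so each tree is translated into a fixed finite number of formulas, and these are
  computed by course-of-values recursion on the code of the tree.\<close>

section \<open>Recursive functions\<close>

text \<open>The rules for \<open>recursive\<close> yield functions of a rigid syntactic shape.
  Demanding agreement on lists of length \<open>n\<close> only allows closure properties for
  convenient terms.\<close>

definition total_recursive :: "nat \<Rightarrow> (nat list \<Rightarrow> nat) \<Rightarrow> bool" where
  "total_recursive n f \<longleftrightarrow> (\<exists>g. recursive n g \<and> (\<forall>xs. length xs = n \<longrightarrow> g xs = f xs))"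

lemma total_recursive_cong:
  "total_recursive n f \<Longrightarrow> (\<And>xs. length xs = n \<Longrightarrow> f xs = g xs) \<Longrightarrow> total_recursive n g"
  unfolding total_recursive_def by metis

lemma total_recursive_zero: "total_recursive n (\<lambda>xs. 0)"
  unfolding total_recursive_def using rec_zero by blast

lemma total_recursive_proj: "i < n \<Longrightarrow> total_recursive n (\<lambda>xs. xs ! i)"
  unfolding total_recursive_def using rec_proj by blast

lemma total_recursive_comp:
  assumes "total_recursive (length fs) g" and "\<And>f. f \<in> set fs \<Longrightarrow> total_recursive n f"
  shows "total_recursive n (\<lambda>xs. g (map (\<lambda>f. f xs) fs))"
proof -
  obtain g' where g': "recursive (length fs) g'" "\<And>xs. length xs = length fs \<Longrightarrow> g' xs = g xs"
    using assms(1) unfolding total_recursive_def by blast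
  obtain r where r: "\<And>f. f \<in> set fs \<Longrightarrow> recursive n (r f)"
      "\<And>f xs. f \<in> set fs \<Longrightarrow> length xs = n \<Longrightarrow> r f xs = f xs"
    using assms(2) unfolding total_recursive_def by metis
  have "recursive n (\<lambda>xs. g' (map (\<lambda>f. f xs) (map r fs)))"
    by (rule rec_comp) (use g'(1) r(1) in auto)
  moreover have "g' (map (\<lambda>f. f xs) (map r fs)) = g (map (\<lambda>f. f xs) fs)" if "length xs = n" for xs
  proof -
    have "map (\<lambda>f. f xs) (map r fs) = map (\<lambda>f. f xs) fs"
      using r(2) that by simp
    then show ?thesis using g'(2) by (simp del: map_map)
  qed
  ultimately show ?thesis unfolding total_recursive_def by blast
qed

lemma total_recursive_comp1:
  "total_recursive 1 (\<lambda>xs. g (xs ! 0)) \<Longrightarrow> total_recursive n f \<Longrightarrow> total_recursive n (\<lambda>xs. g (f xs))"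
  using total_recursive_comp[of "[f]" "\<lambda>xs. g (xs ! 0)" n] by simp

lemma total_recursive_comp2:
  "total_recursive 2 (\<lambda>xs. g (xs ! 0) (xs ! 1)) \<Longrightarrow> total_recursive n f1 \<Longrightarrow> total_recursive n f2
    \<Longrightarrow> total_recursive n (\<lambda>xs. g (f1 xs) (f2 xs))"
  using total_recursive_comp[of "[f1, f2]" "\<lambda>xs. g (xs ! 0) (xs ! 1)" n]
  by (auto simp: numeral_2_eq_2)

lemma total_recursive_prim:
  assumes "total_recursive n f" and "total_recursive (n + 2) g"
  shows "total_recursive (n + 1) (\<lambda>xs. rec_nat (f (tl xs)) (\<lambda>y r. g (y # r # tl xs)) (hd xs))"
proof -
  obtain f' where f': "recursive n f'" "\<And>xs. length xs = n \<Longrightarrow> f' xs = f xs"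
    using assms(1) unfolding total_recursive_def by blast
  obtain g' where g': "recursive (n + 2) g'" "\<And>xs. length xs = n + 2 \<Longrightarrow> g' xs = g xs"
    using assms(2) unfolding total_recursive_def by blast
  have "recursive (n + 1) (\<lambda>xs. rec_nat (f' (tl xs)) (\<lambda>y r. g' (y # r # tl xs)) (hd xs))"
    by (rule rec_prim[OF f'(1) g'(1)])
  moreover have "rec_nat (f' (tl xs)) (\<lambda>y r. g' (y # r # tl xs)) (hd xs)
      = rec_nat (f (tl xs)) (\<lambda>y r. g (y # r # tl xs)) (hd xs)" if "length xs = n + 1" for xs
    using f'(2) g'(2) that by simp
  ultimately show ?thesis unfolding total_recursive_def by blast
qed

lemma total_recursive_min:
  assumes "total_recursive (n + 1) f" and ex: "\<And>xs. length xs = n \<Longrightarrow> \<exists>y. f (y # xs) = 0"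
  shows "total_recursive n (\<lambda>xs. LEAST y. f (y # xs) = 0)"
proof -
  obtain f' where f': "recursive (n + 1) f'" "\<And>xs. length xs = n + 1 \<Longrightarrow> f' xs = f xs"
    using assms(1) unfolding total_recursive_def by blast
  have "recursive n (\<lambda>xs. LEAST y. f' (y # xs) = 0)"
    by (rule rec_min[OF f'(1)]) (use f'(2) ex in simp)
  moreover have "(LEAST y. f' (y # xs) = 0) = (LEAST y. f (y # xs) = 0)" if "length xs = n" for xs
    using f'(2) that by simp
  ultimately show ?thesis unfolding total_recursive_def by blast
qed

lemma total_recursive_Suc: "total_recursive n f \<Longrightarrow> total_recursive n (\<lambda>xs. Suc (f xs))"
  by (rule total_recursive_comp1[of Suc]) (use rec_succ total_recursive_def in auto)

lemma total_recursive_const: "total_recursive n (\<lambda>xs. c)"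
  by (induction c) (simp_all add: total_recursive_zero total_recursive_Suc)

lemma total_recursive_add:
  assumes "total_recursive n f" and "total_recursive n g"
  shows "total_recursive n (\<lambda>xs. f xs + g xs)"
proof (rule total_recursive_comp2[OF _ assms])
  \<comment> \<open>In \<open>y # r # tl xs\<close> index 0 is the counter and index 1 the previous
    value; adding iterates the successor on the latter.\<close>
  have "total_recursive (1 + 1) (\<lambda>xs. rec_nat (tl xs ! 0) (\<lambda>y r. Suc ((y # r # tl xs) ! 1)) (hd xs))"
    by (rule total_recursive_prim) (intro total_recursive_Suc total_recursive_proj, simp)+
  moreover have "rec_nat b (\<lambda>y r. Suc r) a = a + b" for a b :: nat
    by (induction a) auto
  ultimately show "total_recursive 2 (\<lambda>xs. xs ! 0 + xs ! 1)"
    by (auto elim!: total_recursive_cong simp: length_Suc_conv numeral_2_eq_2)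
qed

lemma total_recursive_pred:
  assumes "total_recursive n f"
  shows "total_recursive n (\<lambda>xs. f xs - 1)"
proof (rule total_recursive_comp1[OF _ assms])
  have "total_recursive (0 + 1) (\<lambda>xs. rec_nat 0 (\<lambda>y r. (y # r # tl xs) ! 0) (hd xs))"
    by (rule total_recursive_prim) (simp_all add: total_recursive_zero total_recursive_proj del: nth_Cons_0)
  moreover have "rec_nat 0 (\<lambda>y r. y) a = a - 1" for a :: nat
    by (cases a) auto
  ultimately show "total_recursive 1 (\<lambda>xs. xs ! 0 - 1)"
    by (auto elim!: total_recursive_cong simp: length_Suc_conv)
qed

lemma total_recursive_diff:
  assumes "total_recursive n f" and "total_recursive n g"
  shows "total_recursive n (\<lambda>xs. f xs - g xs)"
\<comment> \<open>Recursion runs on the first argument, so the subtrahend has to come first; hence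
  the swapped assumptions.\<close>
proof (rule total_recursive_comp2[OF _ assms(2,1), where g = "\<lambda>b a. a - b"])
  have "total_recursive (1 + 1) (\<lambda>xs. rec_nat (tl xs ! 0) (\<lambda>y r. (y # r # tl xs) ! 1 - 1) (hd xs))"
    by (rule total_recursive_prim) (intro total_recursive_pred total_recursive_proj, simp)+
  moreover have "rec_nat b (\<lambda>y r. r - 1) a = b - a" for a b :: nat
    by (induction a) auto
  ultimately show "total_recursive 2 (\<lambda>xs. xs ! 1 - xs ! 0)"
    by (auto elim!: total_recursive_cong simp: length_Suc_conv numeral_2_eq_2)
qed

lemma total_recursive_triangle:
  assumes "total_recursive n f"
  shows "total_recursive n (\<lambda>xs. triangle (f xs))"
proof (rule total_recursive_comp1[OF _ assms])
  have "total_recursive (0 + 1)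
      (\<lambda>xs. rec_nat 0 (\<lambda>y r. (y # r # tl xs) ! 1 + Suc ((y # r # tl xs) ! 0)) (hd xs))"
    by (rule total_recursive_prim;
        intro total_recursive_zero total_recursive_add total_recursive_Suc total_recursive_proj; simp)
  moreover have "rec_nat 0 (\<lambda>y r. r + Suc y) a = triangle a" for a :: nat
    by (induction a) auto
  ultimately show "total_recursive 1 (\<lambda>xs. triangle (xs ! 0))"
    by (auto elim!: total_recursive_cong simp: length_Suc_conv)
qed

section \<open>Cantor pairing and its inverses\<close>

abbreviation pair :: "nat \<Rightarrow> nat \<Rightarrow> nat" where
  "pair x y \<equiv> prod_encode (x, y)"

definition pfst :: "nat \<Rightarrow> nat" where
  "pfst n = fst (prod_decode n)"

definition psnd :: "nat \<Rightarrow> nat" where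
  "psnd n = snd (prod_decode n)"

lemma pfst_pair [simp]: "pfst (pair x y) = x"
  and psnd_pair [simp]: "psnd (pair x y) = y"
  by (simp_all add: pfst_def psnd_def)

lemma pair_pfst_psnd: "pair (pfst n) (psnd n) = n"
  by (simp add: pfst_def psnd_def)

text \<open>\<open>triangle (k + x) + k\<close> exceeds \<open>x\<close> as soon as \<open>k\<close>
  is positive, whereas \<open>pair 0 0\<close> is \<open>0\<close>. Recursion on codes rests on
  this: arguments under a nonzero tag have smaller codes.\<close>

lemma psnd_less: "pfst n \<noteq> 0 \<Longrightarrow> psnd n < n"
proof -
  assume *: "pfst n \<noteq> 0"
  have "k \<le> triangle k" for k by (induction k) auto
  from this[of "pfst n + psnd n"] * have "psnd n < pair (pfst n) (psnd n)"
    by (simp add: prod_encode_def)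
  then show ?thesis by (simp add: pair_pfst_psnd)
qed

lemma total_recursive_pair:
  "total_recursive n f \<Longrightarrow> total_recursive n g \<Longrightarrow> total_recursive n (\<lambda>xs. pair (f xs) (g xs))"
  unfolding prod_encode_def by (simp add: total_recursive_add total_recursive_triangle)

text \<open>The index of the diagonal on which the pairing places \<open>n\<close>. Truncated
  subtraction turns \<open>n < triangle (Suc k)\<close> into an equation with 0, the form that
  minimization accepts.\<close>

definition triangle_root :: "nat \<Rightarrow> nat" where
  "triangle_root n = (LEAST k. Suc n - triangle (Suc k) = 0)"

lemma triangle_mono: "m \<le> n \<Longrightarrow> triangle m \<le> triangle n"
  by (induction n rule: nat_induct) (auto simp: le_Suc_eq)

lemma triangle_root_pair: "triangle_root (pair x y) = x + y"
  unfolding triangle_root_def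
proof (rule Least_equality)
  show "Suc (pair x y) - triangle (Suc (x + y)) = 0"
    by (simp add: prod_encode_def)
  show "x + y \<le> k" if "Suc (pair x y) - triangle (Suc k) = 0" for k
  proof (rule ccontr)
    assume "\<not> x + y \<le> k"
    then have "triangle (Suc k) \<le> triangle (x + y)" by (intro triangle_mono) simp
    with that show False by (simp add: prod_encode_def)
  qed
qed

text \<open>Since \<open>pair x y = triangle (x + y) + x\<close>, the diagonal index determines both
  components. The resulting expressions use only subtraction, triangle numbers and
  minimization.\<close>

lemma pfst_eq: "pfst n = n - triangle (triangle_root n)"
  and psnd_eq: "psnd n = triangle_root n - pfst n"
proof -
  have root: "triangle_root n = pfst n + psnd n"
    using triangle_root_pair[of "pfst n" "psnd n"] by (simp add: pair_pfst_psnd)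
  then show "psnd n = triangle_root n - pfst n" by simp
  have "n = triangle (pfst n + psnd n) + pfst n"
    using pair_pfst_psnd[of n] by (simp add: prod_encode_def)
  with root show "pfst n = n - triangle (triangle_root n)" by simp
qed

lemma total_recursive_triangle_root:
  assumes "total_recursive n f"
  shows "total_recursive n (\<lambda>xs. triangle_root (f xs))"
proof (rule total_recursive_comp1[OF _ assms])
  let ?f = "\<lambda>xs. Suc (xs ! 1) - triangle (Suc (xs ! 0))"
  have "total_recursive 1 (\<lambda>xs. LEAST y. ?f (y # xs) = 0)"
  proof (rule total_recursive_min)
    show "total_recursive (1 + 1) ?f"
      by (intro total_recursive_diff total_recursive_Suc total_recursive_triangle
          total_recursive_proj) simp_all
    show "\<exists>y. ?f (y # xs) = 0" for xs :: "nat list"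
      by (rule exI[of _ "xs ! 0"]) simp
  qed
  then show "total_recursive 1 (\<lambda>xs. triangle_root (xs ! 0))"
    by (rule total_recursive_cong) (simp add: triangle_root_def del: triangle_Suc)
qed

text \<open>Pairing makes unary functions sufficient, so that the closure properties below apply to
  terms in one variable.\<close>

definition computable :: "(nat \<Rightarrow> nat) \<Rightarrow> bool" where
  "computable f \<longleftrightarrow> total_recursive 1 (\<lambda>xs. f (xs ! 0))"

named_theorems computable_intros

lemma computable_comp:
  "computable f \<Longrightarrow> computable g \<Longrightarrow> computable (\<lambda>x. f (g x))"
  unfolding computable_def by (rule total_recursive_comp1)

lemma computable_id [computable_intros]: "computable (\<lambda>x. x)"
  unfolding computable_def by (rule total_recursive_proj) simp

lemma computable_const [computable_intros]: "computable (\<lambda>x. c)"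
  unfolding computable_def by (rule total_recursive_const)

lemma computable_add [computable_intros]:
  "computable f \<Longrightarrow> computable g \<Longrightarrow> computable (\<lambda>x. f x + g x)"
  unfolding computable_def by (rule total_recursive_add)

lemma computable_diff [computable_intros]:
  "computable f \<Longrightarrow> computable g \<Longrightarrow> computable (\<lambda>x. f x - g x)"
  unfolding computable_def by (rule total_recursive_diff)

lemma computable_Suc [computable_intros]: "computable f \<Longrightarrow> computable (\<lambda>x. Suc (f x))"
  unfolding computable_def by (rule total_recursive_Suc)

lemma computable_pair [computable_intros]:
  "computable f \<Longrightarrow> computable g \<Longrightarrow> computable (\<lambda>x. pair (f x) (g x))"
  unfolding computable_def by (rule total_recursive_pair)

lemma computable_pfst [computable_intros]: "computable f \<Longrightarrow> computable (\<lambda>x. pfst (f x))"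
  unfolding computable_def pfst_eq
  by (intro total_recursive_diff total_recursive_triangle total_recursive_triangle_root)

lemma computable_psnd [computable_intros]: "computable f \<Longrightarrow> computable (\<lambda>x. psnd (f x))"
  unfolding computable_def psnd_eq pfst_eq
  by (intro total_recursive_diff total_recursive_triangle total_recursive_triangle_root)

text \<open>The parameter \<open>x\<close> may occur in the base, in the step and in the number of
  iterations. Nested pairing makes the ternary step unary, so that \<open>computable\<close> applies
  to it.\<close>

lemma computable_rec_nat:
  assumes z: "computable z" and m: "computable m"
    and s: "computable (\<lambda>p. s (pfst p) (pfst (psnd p)) (psnd (psnd p)))"
  shows "computable (\<lambda>x. rec_nat (z x) (\<lambda>y r. s y r x) (m x))"
proof -
  let ?g = "\<lambda>xs. s (xs ! 0) (xs ! 1) (xs ! 2)"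
  have "total_recursive (1 + 2) (\<lambda>xs. pair (xs ! 0) (pair (xs ! 1) (xs ! 2)))"
    by (intro total_recursive_pair total_recursive_proj) simp_all
  from total_recursive_comp1[OF s[unfolded computable_def] this]
  have g: "total_recursive (1 + 2) ?g" by simp
  have "total_recursive (1 + 1) (\<lambda>xs. rec_nat (z (tl xs ! 0)) (\<lambda>y r. ?g (y # r # tl xs)) (hd xs))"
    by (rule total_recursive_prim[OF z[unfolded computable_def] g])
  then have "total_recursive 2 (\<lambda>xs. rec_nat (z (xs ! 1)) (\<lambda>y r. s y r (xs ! 1)) (xs ! 0))"
    by (auto elim!: total_recursive_cong simp: length_Suc_conv numeral_2_eq_2)
  from total_recursive_comp2[OF this m[unfolded computable_def] total_recursive_proj[of 0 1]]
  show ?thesis unfolding computable_def by simp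
qed

lemma computable_if [computable_intros]:
  assumes "computable f" "computable g" "computable h" "computable k"
  shows "computable (\<lambda>x. if f x = g x then h x else k x)"
proof -
  have "computable (\<lambda>p. k (psnd (psnd p)))"
    by (intro computable_comp[OF assms(4)] computable_intros)
  \<comment> \<open>The number of iterations is the distance of the two values, zero exactly when
    they are equal; any positive number of steps yields \<open>k x\<close>.\<close>
  then have "computable (\<lambda>x. rec_nat (h x) (\<lambda>y r. k x) ((f x - g x) + (g x - f x)))"
    by (intro computable_rec_nat computable_intros assms)
  moreover have "rec_nat a (\<lambda>y r. b) ((c - d) + (d - c)) = (if c = d then a else b)"
    for a b c d :: nat
    by (cases "(c - d) + (d - c)") auto
  ultimately show ?thesis by simp
qed

text \<open>Finitely many case distinctions with constant results suffice, so \<open>f\<close>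
  itself may be arbitrary. This serves the table of the propositions.\<close>

lemma computable_finite_table: "computable (\<lambda>x. if x < N then f x else 0)"
proof (induction N)
  case 0
  then show ?case by (simp add: computable_const)
next
  case (Suc N)
  then have "computable (\<lambda>x. if x = N then f N else if x < N then f x else 0)"
    by (intro computable_intros)
  moreover have "(\<lambda>x. if x = N then f N else if x < N then f x else 0)
      = (\<lambda>x. if x < Suc N then f x else 0)" by (auto simp: less_Suc_eq)
  ultimately show ?case by simp
qed

subsection \<open>Course-of-values recursion\<close>

text \<open>The values at all smaller arguments, stored as nested pairs with the latest outermost;
  \<open>h\<close> receives the argument and this store.\<close>

primrec history :: "(nat \<Rightarrow> nat \<Rightarrow> nat) \<Rightarrow> nat \<Rightarrow> nat" where
  "history h 0 = 0"
| "history h (Suc n) = pair (h n (history h n)) (history h n)"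

definition cov_rec :: "(nat \<Rightarrow> nat \<Rightarrow> nat) \<Rightarrow> nat \<Rightarrow> nat" where
  "cov_rec h n = h n (history h n)"

text \<open>Above the entry for \<open>m\<close> lie those for \<open>m + 1, ..., n - 1\<close>,
  hence \<open>n - Suc m\<close> removals before the top is read.\<close>

definition recall :: "nat \<Rightarrow> nat \<Rightarrow> nat \<Rightarrow> nat" where
  "recall n t m = pfst (rec_nat t (\<lambda>_. psnd) (n - Suc m))"

lemma recall_history: "m < n \<Longrightarrow> recall n (history h n) m = cov_rec h m"
proof -
  have "rec_nat (history h (d + k)) (\<lambda>_. psnd) d = history h k" for d k
  proof -
    \<comment> \<open>Here \<open>j\<close> entries have been removed; keeping the height
      \<open>d + k\<close> fixed makes the induction on \<open>j\<close> possible.\<close>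
    have "j \<le> d \<Longrightarrow> rec_nat (history h (d + k)) (\<lambda>_. psnd) j = history h (d - j + k)" for j
    proof (induction j)
      case (Suc j)
      then have "d - j + k = Suc (d - Suc j + k)" by simp
      with Suc show ?case by simp
    qed simp
    from this[of d] show ?thesis by simp
  qed
  from this[of "n - Suc m" "Suc m"] show "m < n \<Longrightarrow> ?thesis"
    by (simp add: recall_def cov_rec_def)
qed

lemma computable_recall [computable_intros]:
  "computable n \<Longrightarrow> computable t \<Longrightarrow> computable m \<Longrightarrow> computable (\<lambda>x. recall (n x) (t x) (m x))"
  unfolding recall_def by (intro computable_intros computable_rec_nat)

lemma computable_cov_rec:
  assumes "computable (\<lambda>p. h (pfst p) (psnd p))"
  shows "computable (cov_rec h)"
proof -
  have h: "computable (\<lambda>x. h (f x) (g x))" if "computable f" "computable g" for f g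
    using computable_comp[OF assms computable_pair[OF that]] by simp
  have "history h n = rec_nat 0 (\<lambda>y r. pair (h y r) r) n" for n
    by (induction n) auto
  moreover have "computable (\<lambda>n. rec_nat 0 (\<lambda>y r. pair (h y r) r) n)"
    by (intro computable_rec_nat computable_intros h)
  ultimately have "computable (history h)" by presburger
  then have "computable (\<lambda>n. h n (history h n))"
    by (intro h computable_intros)
  then show ?thesis unfolding cov_rec_def[abs_def] .
qed


section \<open>Translation of trees into formulas\<close>

text \<open>The formulas use only three variables: a factor of the word is the part strictly after
  the position in variable 2 up to and including the position in variable 3, and variable 4 is
  used for cutting it. Since there is no position before the first letter, prefixes are handled
  by separate formulas without variable 2, selected by the flag \<open>s\<close>. The flag \<open>b\<close> is the
  polarity: negation is pushed inwards by providing a formula for the complement as well.\<close>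

definition factor :: "bool \<Rightarrow> 'a list \<Rightarrow> (nat \<Rightarrow> nat) \<Rightarrow> 'a list" where
  "factor s w \<sigma> = drop (if s then 0 else Suc (\<sigma> 2)) (take (Suc (\<sigma> 3)) w)"

text \<open>The first component tells whether the empty word belongs to the language.\<close>

type_synonym 'p rep = "bool \<times> (bool \<Rightarrow> bool \<Rightarrow> 'p fo)"

text \<open>With \<open>b\<close> false the formula describes the complement. A factor is empty when
  \<open>\<sigma> 3 \<le> \<sigma> 2\<close>, but a prefix never is, as it contains the position in
  variable 3; only the separate bit decides the empty word as a whole.\<close>

definition represents :: "'p rep \<Rightarrow> 'p trace set \<Rightarrow> bool" where
  "represents r L \<longleftrightarrow> (fst r \<longleftrightarrow> [] \<in> L) \<and>
     (\<forall>w \<sigma> b s. \<sigma> 2 < length w \<longrightarrow> \<sigma> 3 < length w \<longrightarrow>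
        (sat w \<sigma> (snd r b s) \<longleftrightarrow> b = (factor s w \<sigma> \<in> L)))"

definition sigma_pi :: "bool \<Rightarrow> nat \<Rightarrow> 'p fo \<Rightarrow> bool" where
  "sigma_pi b l \<phi> \<longleftrightarrow> (if b then Sigma_fo l \<phi> else Pi_fo l \<phi>)"

definition has_level :: "nat \<Rightarrow> 'p rep \<Rightarrow> bool" where
  "has_level l r \<longleftrightarrow> (\<forall>b s. sigma_pi b l (snd r b s) \<and>
     free_vars (snd r b s) \<subseteq> (if s then {3} else {2, 3}))"

section \<open>Connectives and quantifiers with a polarity\<close>

definition lit :: "bool \<Rightarrow> 'p fo \<Rightarrow> 'p fo" where
  "lit b \<phi> = (if b then \<phi> else Neg \<phi>)"

text \<open>For \<open>b\<close> false this is the De Morgan dual, as \<open>ex_fo\<close> is for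
  the quantifier: one scheme written with \<open>b\<close> yields both a formula for a condition and
  one for its negation.\<close>

definition conj_fo :: "bool \<Rightarrow> 'p fo \<Rightarrow> 'p fo \<Rightarrow> 'p fo" where
  "conj_fo b \<phi> \<psi> = (if b then Conj \<phi> \<psi> else Disj \<phi> \<psi>)"

abbreviation disj_fo :: "bool \<Rightarrow> 'p fo \<Rightarrow> 'p fo \<Rightarrow> 'p fo" where
  "disj_fo b \<equiv> conj_fo (\<not> b)"

definition ex_fo :: "bool \<Rightarrow> nat \<Rightarrow> 'p fo \<Rightarrow> 'p fo" where
  "ex_fo b x \<phi> = (if b then Exi x \<phi> else Uni x \<phi>)"

text \<open>The syntax has no truth constants; a formula in variable 3 alone is admissible for
  factors and prefixes alike.\<close>

definition truth :: "bool \<Rightarrow> 'p fo" where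
  "truth e = lit (\<not> e) (Less 3 3)"

text \<open>Renaming by an equality guard instead of syntactic substitution avoids capture of
  variable 4, which may be bound inside \<open>\<phi>\<close>. The quantifier follows
  \<open>b\<close>, so that no level is lost.\<close>

definition subst_fo :: "bool \<Rightarrow> nat \<Rightarrow> nat \<Rightarrow> 'p fo \<Rightarrow> 'p fo" where
  "subst_fo b x y \<phi> =
     ex_fo b x (conj_fo b (lit b (Conj (Neg (Less x y)) (Neg (Less y x)))) \<phi>)"

lemma sat_lit: "sat w \<sigma> (lit b \<phi>) \<longleftrightarrow> b = sat w \<sigma> \<phi>"
  by (cases b) (simp_all add: lit_def)

lemma sat_truth: "sat w \<sigma> (truth e) \<longleftrightarrow> e"
  by (simp add: truth_def sat_lit)

lemma sat_conj_fo:
  "sat w \<sigma> \<phi> \<longleftrightarrow> b = P \<Longrightarrow> sat w \<sigma> \<psi> \<longleftrightarrow> b = Q \<Longrightarrow> sat w \<sigma> (conj_fo b \<phi> \<psi>) \<longleftrightarrow> b = (P \<and> Q)"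
  by (cases b) (simp_all add: conj_fo_def)

lemma sat_disj_fo:
  "sat w \<sigma> \<phi> \<longleftrightarrow> b = P \<Longrightarrow> sat w \<sigma> \<psi> \<longleftrightarrow> b = Q \<Longrightarrow> sat w \<sigma> (disj_fo b \<phi> \<psi>) \<longleftrightarrow> b = (P \<or> Q)"
  by (cases b) (simp_all add: conj_fo_def)

lemma sat_ex_fo:
  "(\<And>i. i < length w \<Longrightarrow> sat w (\<sigma>(x := i)) \<phi> \<longleftrightarrow> b = P i)
    \<Longrightarrow> sat w \<sigma> (ex_fo b x \<phi>) \<longleftrightarrow> b = (\<exists>i<length w. P i)"
  by (cases b) (auto simp: ex_fo_def)

text \<open>Exactly one position satisfies the guard, so the existential and the universal version
  agree. That position must lie in the word, and \<open>x\<close> must differ from \<open>y\<close>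
  for \<open>\<sigma> y\<close> to survive the update.\<close>

lemma sat_subst_fo:
  assumes "x \<noteq> y" and "\<sigma> y < length w"
  shows "sat w \<sigma> (subst_fo b x y \<phi>) \<longleftrightarrow> sat w (\<sigma>(x := \<sigma> y)) \<phi>"
proof -
  have "\<not> i < \<sigma> y \<and> \<not> \<sigma> y < i \<longleftrightarrow> i = \<sigma> y" for i by auto
  with assms show ?thesis
    by (cases b) (auto simp: subst_fo_def ex_fo_def conj_fo_def lit_def simp del: not_less)
qed

lemma Sigma_quantifier_free: "quantifier_free \<phi> \<Longrightarrow> Sigma_fo l \<phi>"
  by (induction l) (auto intro: Sigma_fo_Pi_fo.intros)

lemma Pi_quantifier_free: "quantifier_free \<phi> \<Longrightarrow> Pi_fo l \<phi>"
  by (induction l) (auto intro: Sigma_fo_Pi_fo.intros)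

lemma sigma_pi_quantifier_free: "quantifier_free \<phi> \<Longrightarrow> sigma_pi b l \<phi>"
  by (simp add: sigma_pi_def Sigma_quantifier_free Pi_quantifier_free)

lemma sigma_pi_conj_fo:
  "sigma_pi b (Suc l) \<phi> \<Longrightarrow> sigma_pi b (Suc l) \<psi> \<Longrightarrow> sigma_pi b (Suc l) (conj_fo c \<phi> \<psi>)"
  by (auto simp: sigma_pi_def conj_fo_def intro: Sigma_fo_Pi_fo.intros split: if_splits)

lemma sigma_pi_ex_fo: "sigma_pi b (Suc l) \<phi> \<Longrightarrow> sigma_pi b (Suc l) (ex_fo b x \<phi>)"
  by (auto simp: sigma_pi_def ex_fo_def intro: Sigma_fo_Pi_fo.intros)

lemma quantifier_free_lit [simp]: "quantifier_free (lit b \<phi>) \<longleftrightarrow> quantifier_free \<phi>"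
  by (simp add: lit_def)

lemma quantifier_free_truth [simp]: "quantifier_free (truth e)"
  by (simp add: truth_def)

lemma sigma_pi_subst_fo: "sigma_pi b (Suc l) \<phi> \<Longrightarrow> sigma_pi b (Suc l) (subst_fo b x y \<phi>)"
  unfolding subst_fo_def
  by (intro sigma_pi_ex_fo sigma_pi_conj_fo, rule sigma_pi_quantifier_free) simp_all

lemma free_vars_simps [simp]:
  "free_vars (lit b \<phi>) = free_vars \<phi>"
  "free_vars (truth e) = {3}"
  "free_vars (conj_fo b \<phi> \<psi>) = free_vars \<phi> \<union> free_vars \<psi>"
  "free_vars (ex_fo b x \<phi>) = free_vars \<phi> - {x}"
  by (simp_all add: lit_def truth_def conj_fo_def ex_fo_def)

lemma free_vars_subst_fo: "free_vars (subst_fo b x y \<phi>) \<subseteq> insert y (free_vars \<phi> - {x})"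
  by (auto simp: subst_fo_def)

subsection \<open>Operations on representations\<close>

definition all_rep :: "'p rep" where
  "all_rep = (True, \<lambda>b s. truth b)"

definition empty_rep :: "'p rep" where
  "empty_rep = (False, \<lambda>b s. truth (\<not> b))"

text \<open>A prefix is never empty; any other factor is empty exactly when variable 2 is not below
  variable 3.\<close>

definition eps_rep :: "'p rep" where
  "eps_rep = (True, \<lambda>b s. if s then truth (\<not> b) else lit (\<not> b) (Less 2 3))"

definition or_rep :: "'p rep \<Rightarrow> 'p rep \<Rightarrow> 'p rep" where
  "or_rep r r' = (fst r \<or> fst r', \<lambda>b s. disj_fo b (snd r b s) (snd r' b s))"

definition and_rep :: "'p rep \<Rightarrow> 'p rep \<Rightarrow> 'p rep" where
  "and_rep r r' = (fst r \<and> fst r', \<lambda>b s. conj_fo b (snd r b s) (snd r' b s))"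

definition diff_rep :: "'p rep \<Rightarrow> 'p rep \<Rightarrow> 'p rep" where
  "diff_rep r r' = (fst r \<and> \<not> fst r', \<lambda>b s. conj_fo b (snd r b s) (snd r' (\<not> b) s))"

text \<open>A nonempty left part of a factor ends at the position in variable 4. For prefixes the guard
  \<open>\<not> 4 < 2\<close> is replaced by the trivial \<open>\<not> 4 < 4\<close>.\<close>

definition conc_rep :: "'p rep \<Rightarrow> 'p rep \<Rightarrow> 'p rep" where
  "conc_rep r r' = (fst r \<and> fst r', \<lambda>b s.
     disj_fo b (conj_fo b (truth (b = fst r)) (snd r' b s))
       (ex_fo b 4 (conj_fo b
         (lit b (Conj (Neg (Less 4 (if s then 4 else 2))) (Neg (Less 3 4))))
         (conj_fo b (subst_fo b 3 4 (snd r b s)) (subst_fo b 2 4 (snd r' b False))))))"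

lemma represents_all: "represents all_rep UNIV"
  by (simp add: represents_def all_rep_def sat_truth)

lemma represents_empty: "represents empty_rep {}"
  by (simp add: represents_def empty_rep_def sat_truth)

lemma represents_eps: "represents eps_rep {[]}"
  by (auto simp: represents_def eps_rep_def sat_truth sat_lit factor_def)

lemma represents_or: "represents r L \<Longrightarrow> represents r' L' \<Longrightarrow> represents (or_rep r r') (L \<union> L')"
  by (auto simp: represents_def or_rep_def conj_fo_def)

lemma represents_and: "represents r L \<Longrightarrow> represents r' L' \<Longrightarrow> represents (and_rep r r') (L \<inter> L')"
  by (auto simp: represents_def and_rep_def conj_fo_def)

lemma represents_diff: "represents r L \<Longrightarrow> represents r' L' \<Longrightarrow> represents (diff_rep r r') (L - L')"
  by (auto simp: represents_def diff_rep_def conj_fo_def)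

text \<open>An empty left part is left to the test \<open>[] \<in> L\<close>, a nonempty one is cut
  at the position \<open>i\<close> of its last letter. For \<open>s\<close> false,
  \<open>i = \<sigma> 2\<close> gives an empty left part again, harmlessly, because the right part
  is then the whole factor.\<close>

lemma factor_mem_conc:
  assumes "\<sigma> 2 < length w" and "\<sigma> 3 < length w"
  shows "factor s w \<sigma> \<in> conc L M \<longleftrightarrow> [] \<in> L \<and> factor s w \<sigma> \<in> M \<or>
    (\<exists>i<length w. (s \<or> \<sigma> 2 \<le> i) \<and> i \<le> \<sigma> 3 \<and> factor s w (\<sigma>(3 := i)) \<in> L \<and>
       factor False w (\<sigma>(2 := i)) \<in> M)" (is "?lhs \<longleftrightarrow> ?eps \<or> ?cut")
proof
  assume ?lhs
  then obtain u v where uv: "factor s w \<sigma> = u @ v" "u \<in> L" "v \<in> M"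
    by (auto simp: conc_def)
  show "?eps \<or> ?cut"
  proof (cases "u = []")
    case True
    then show ?thesis using uv by simp
  next
    case False
    define j where "j = (if s then 0 else Suc (\<sigma> 2))"
    \<comment> \<open>The position of the last letter of \<open>u\<close>, as the factor starts at
      position \<open>j\<close>.\<close>
    define i where "i = j + length u - 1"
    have Suc_i: "Suc i = j + length u" using False by (simp add: i_def)
    have len: "length u + length v = Suc (\<sigma> 3) - j"
      unfolding j_def using arg_cong[OF uv(1), of length] assms by (simp add: factor_def)
    have le: "i \<le> \<sigma> 3" using len Suc_i False by (cases u) auto
    have "take (length u) (drop j (take (Suc (\<sigma> 3)) w)) = u"
      "drop (length u) (drop j (take (Suc (\<sigma> 3)) w)) = v"
      using uv(1) by (simp_all add: factor_def j_def)
    moreover have "factor s w (\<sigma>(3 := i)) = drop j (take (Suc i) w)"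
      by (simp add: factor_def j_def)
    ultimately have "factor s w (\<sigma>(3 := i)) = u" "factor False w (\<sigma>(2 := i)) = v"
      using Suc_i le by (simp_all add: factor_def take_drop add.commute min_def)
    moreover have "s \<or> \<sigma> 2 \<le> i" using Suc_i False by (cases s) (auto simp: j_def)
    ultimately show ?thesis using uv le assms(2) by (intro disjI2 exI[of _ i]) auto
  qed
next
  assume "?eps \<or> ?cut"
  then show ?lhs
  proof
    assume ?eps
    then show ?lhs unfolding conc_def by (auto intro: exI[of _ "[]"])
  next
    assume ?cut
    then obtain i where i: "s \<or> \<sigma> 2 \<le> i" "i \<le> \<sigma> 3" "factor s w (\<sigma>(3 := i)) \<in> L"
      "factor False w (\<sigma>(2 := i)) \<in> M" by blast
    define j where "j = (if s then 0 else Suc (\<sigma> 2))"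
    have "j \<le> Suc i" using i(1) by (auto simp: j_def)
    \<comment> \<open>As \<open>i \<le> \<sigma> 3\<close>, the longer prefix splits after position
      \<open>i\<close>; since \<open>j \<le> Suc i\<close>, dropping \<open>j\<close> letters
      affects only the first piece.\<close>
    have "take (Suc (\<sigma> 3)) w = take (Suc i) w @ drop (Suc i) (take (Suc (\<sigma> 3)) w)"
      using i(2) by (metis Suc_le_mono append_take_drop_id min_def take_take)
    then have "factor s w \<sigma> = drop j (take (Suc i) w @ drop (Suc i) (take (Suc (\<sigma> 3)) w))"
      by (simp add: factor_def j_def)
    also have "\<dots> = drop j (take (Suc i) w) @ drop (Suc i) (take (Suc (\<sigma> 3)) w)"
      using \<open>j \<le> Suc i\<close> by (cases "Suc i \<le> length w") (simp_all add: min_def)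
    finally have "factor s w \<sigma> = factor s w (\<sigma>(3 := i)) @ factor False w (\<sigma>(2 := i))"
      by (simp add: factor_def j_def)
    with i show ?lhs unfolding conc_def by blast
  qed
qed

lemma represents_conc:
  assumes r: "represents r L" and r': "represents r' L'"
  shows "represents (conc_rep r r') (conc L L')"
  unfolding represents_def
proof (intro conjI allI impI)
  show "fst (conc_rep r r') \<longleftrightarrow> [] \<in> conc L L'"
    using assms by (auto simp: represents_def conc_rep_def conc_def)
next
  fix w :: "'a trace" and \<sigma> :: "nat \<Rightarrow> nat" and b s
  assume \<sigma>: "\<sigma> 2 < length w" "\<sigma> 3 < length w"
  have e: "fst r \<longleftrightarrow> [] \<in> L" using r by (simp add: represents_def)
  have "sat w \<sigma> (snd (conc_rep r r') b s) \<longleftrightarrow> b = ([] \<in> L \<and> factor s w \<sigma> \<in> L' \<or>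
    (\<exists>i<length w. ((s \<or> \<sigma> 2 \<le> i) \<and> i \<le> \<sigma> 3) \<and> factor s w (\<sigma>(3 := i)) \<in> L \<and>
       factor False w (\<sigma>(2 := i)) \<in> L'))"
    unfolding conc_rep_def snd_conv
  proof (intro sat_disj_fo sat_conj_fo sat_ex_fo)
    show "sat w \<sigma> (truth (b = fst r)) \<longleftrightarrow> b = ([] \<in> L)"
      by (simp add: sat_truth e)
    show "sat w \<sigma> (snd r' b s) \<longleftrightarrow> b = (factor s w \<sigma> \<in> L')"
      using r' \<sigma> by (simp add: represents_def)
  next
    fix i assume i: "i < length w"
    show "sat w (\<sigma>(4 := i)) (lit b (Conj (Neg (Less 4 (if s then 4 else 2))) (Neg (Less 3 4))))
       \<longleftrightarrow> b = ((s \<or> \<sigma> 2 \<le> i) \<and> i \<le> \<sigma> 3)"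
      by (auto simp: sat_lit)
    show "sat w (\<sigma>(4 := i)) (subst_fo b 3 4 (snd r b s)) \<longleftrightarrow> b = (factor s w (\<sigma>(3 := i)) \<in> L)"
      using r \<sigma> i by (simp add: sat_subst_fo represents_def factor_def)
    show "sat w (\<sigma>(4 := i)) (subst_fo b 2 4 (snd r' b False))
       \<longleftrightarrow> b = (factor False w (\<sigma>(2 := i)) \<in> L')"
      using r' \<sigma> i by (simp add: sat_subst_fo represents_def factor_def)
  qed
  then show "sat w \<sigma> (snd (conc_rep r r') b s) \<longleftrightarrow> b = (factor s w \<sigma> \<in> conc L L')"
    by (simp add: factor_mem_conc[OF \<sigma>])
qed

section \<open>Levels and free variables of the operations\<close>

lemma has_levelD:
  assumes "has_level l r"
  shows "sigma_pi b l (snd r b s)" and "free_vars (snd r b s) \<subseteq> (if s then {3} else {2, 3})"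
  using assms unfolding has_level_def by blast+

lemma has_level_all: "has_level (Suc l) all_rep"
  and has_level_empty: "has_level (Suc l) empty_rep"
  and has_level_eps: "has_level (Suc l) eps_rep"
  by (auto simp: has_level_def all_rep_def empty_rep_def eps_rep_def intro!: sigma_pi_quantifier_free)

lemma has_level_or: "has_level (Suc l) r \<Longrightarrow> has_level (Suc l) r' \<Longrightarrow> has_level (Suc l) (or_rep r r')"
  and has_level_and: "has_level (Suc l) r \<Longrightarrow> has_level (Suc l) r' \<Longrightarrow> has_level (Suc l) (and_rep r r')"
  by (simp_all add: has_level_def or_rep_def and_rep_def sigma_pi_conj_fo)

lemma sigma_pi_dual: "sigma_pi (\<not> b) l \<phi> \<Longrightarrow> sigma_pi b (Suc l) \<phi>"
  by (cases b) (auto simp: sigma_pi_def intro: Sigma_fo_Pi_fo.intros)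

text \<open>The subtrahend enters with the opposite polarity, so its \<open>\<Pi>\<close> formula
  has to count as a \<open>\<Sigma>\<close> formula and dually. This costs one level, hence
  \<open>r'\<close> has to be one level lower than \<open>r\<close>.\<close>

lemma has_level_diff:
  "has_level (Suc l) r \<Longrightarrow> has_level l r' \<Longrightarrow> has_level (Suc l) (diff_rep r r')"
  by (simp add: has_level_def diff_rep_def sigma_pi_conj_fo sigma_pi_dual)

lemma has_level_conc:
  assumes "has_level (Suc l) r" and "has_level (Suc l) r'"
  shows "has_level (Suc l) (conc_rep r r')"
proof -
  note r = has_levelD[OF assms(1)] and r' = has_levelD[OF assms(2)]
  have "sigma_pi b (Suc l) (snd (conc_rep r r') b s)" for b s
    unfolding conc_rep_def snd_conv
    by (intro sigma_pi_conj_fo sigma_pi_ex_fo sigma_pi_subst_fo r r' sigma_pi_quantifier_free) simp_all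
  moreover have "free_vars (snd (conc_rep r r') b s) \<subseteq> (if s then {3} else {2, 3})" for b s
    using r(2)[of b s] r'(2)[of b s] r'(2)[of b False]
      free_vars_subst_fo[of b 3 4 "snd r b s"] free_vars_subst_fo[of b 2 4 "snd r' b False"]
    by (auto simp: conc_rep_def split: if_splits)
  ultimately show ?thesis by (simp add: has_level_def)
qed

subsection \<open>Trees\<close>

primrec any_letter :: "'p letter list \<Rightarrow> 'p fo" where
  "any_letter [] = Less 3 3"
| "any_letter (a # as) = Disj (Letter a 3) (any_letter as)"

text \<open>An atom becomes a finite disjunction over the letters that make it true. The order in
  which \<open>SOME\<close> lists them is irrelevant to the meaning.\<close>

primrec pform_fo :: "'p::finite pform \<Rightarrow> 'p fo" where
  "pform_fo (PAtom p) = any_letter (SOME as. set as = {a. p \<in> a})"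
| "pform_fo (PNot \<gamma>) = Neg (pform_fo \<gamma>)"
| "pform_fo (PAnd \<gamma> \<delta>) = Conj (pform_fo \<gamma>) (pform_fo \<delta>)"
| "pform_fo (POr \<gamma> \<delta>) = Disj (pform_fo \<gamma>) (pform_fo \<delta>)"

lemma sat_any_letter: "sat w \<sigma> (any_letter as) \<longleftrightarrow> w ! \<sigma> 3 \<in> set as"
  by (induction as) auto

lemma any_letter_props: "quantifier_free (any_letter as)" "free_vars (any_letter as) = {3}"
  by (induction as) auto

lemma sat_pform_fo: "sat w \<sigma> (pform_fo \<gamma>) \<longleftrightarrow> pmodels (w ! \<sigma> 3) \<gamma>"
proof (induction \<gamma>)
  case (PAtom p)
  have "set (SOME as. set as = {a. p \<in> a}) = {a. p \<in> a}"
    by (rule someI_ex, rule finite_list) simp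
  then show ?case by (simp add: sat_any_letter)
qed simp_all

lemma pform_fo_props: "quantifier_free (pform_fo \<gamma>)" "free_vars (pform_fo \<gamma>) = {3}"
  by (induction \<gamma>) (simp_all add: any_letter_props)

definition leaf_rep :: "'p fo \<Rightarrow> 'p rep" where
  "leaf_rep \<phi> = (False, \<lambda>b s. lit b (if s then \<phi> else Conj (Less 2 3) \<phi>))"

lemma represents_leaf: "represents (leaf_rep (pform_fo \<gamma>)) (sem (Leaf \<gamma>))"
proof -
  have "last (take (Suc i) w) = w ! i" if "i < length w" for i and w :: "'a trace"
    using that by (simp add: take_Suc_conv_app_nth)
  then show ?thesis
    by (auto simp: represents_def leaf_rep_def sat_lit sat_pform_fo factor_def not_less Suc_le_eq)
qed

lemma has_level_leaf: "has_level (Suc l) (leaf_rep (pform_fo \<gamma>))"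
  by (auto simp: has_level_def leaf_rep_def pform_fo_props intro!: sigma_pi_quantifier_free)

definition or_list :: "'p rep list \<Rightarrow> 'p rep" where
  "or_list rs = foldr or_rep rs empty_rep"

definition conc_list :: "'p rep list \<Rightarrow> 'p rep" where
  "conc_list rs = foldr conc_rep rs eps_rep"

definition prefix_list :: "'p rep list \<Rightarrow> 'p rep" where
  "prefix_list rs = foldr (\<lambda>r. and_rep (conc_rep r all_rep)) rs all_rep"

primrec tree_rep :: "'p::finite adt \<Rightarrow> 'p rep" where
  "tree_rep Eps = eps_rep"
| "tree_rep (Leaf \<gamma>) = leaf_rep (pform_fo \<gamma>)"
| "tree_rep (OR ts) = or_list (map tree_rep ts)"
| "tree_rep (SAND ts) = conc_list (map tree_rep ts)"
| "tree_rep (AND ts) = and_rep (or_list (map tree_rep ts)) (prefix_list (map tree_rep ts))"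
| "tree_rep (C t u) = diff_rep (tree_rep t) (tree_rep u)"

text \<open>Each \<open>L\<close> is contained in \<open>conc L UNIV\<close>, so the index
  \<open>j = i\<close> may be added to the inner intersection, which then no longer depends on
  \<open>i\<close>.\<close>

lemma and_lang_eq: "and_lang Ls = \<Union> (set Ls) \<inter> (\<Inter>L\<in>set Ls. conc L UNIV)"
proof -
  have "L \<subseteq> conc L UNIV" for L :: "'a list set"
    unfolding conc_def by force
  then have "and_lang Ls = (\<Union>i<length Ls. Ls ! i \<inter> (\<Inter>j<length Ls. conc (Ls ! j) UNIV))"
    unfolding and_lang_def by (intro SUP_cong refl) blast
  also have "\<dots> = \<Union> (set Ls) \<inter> (\<Inter>L\<in>set Ls. conc L UNIV)"
    unfolding set_conv_nth by blast
  finally show ?thesis .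
qed

lemma represents_lists:
  assumes "\<forall>t\<in>set ts. represents (f t) (g t)"
  shows "represents (or_list (map f ts)) (\<Union> (set (map g ts)))"
    and "represents (conc_list (map f ts)) (foldr conc (map g ts) {[]})"
    and "represents (prefix_list (map f ts)) (\<Inter>L\<in>set (map g ts). conc L UNIV)"
  using assms
  by (induction ts)
    (simp_all add: or_list_def conc_list_def prefix_list_def represents_empty represents_eps
      represents_all represents_or represents_conc represents_and)

lemma represents_tree: "represents (tree_rep \<theta>) (sem \<theta>)"
proof (induction \<theta>)
  case (AND ts)
  then show ?case
    unfolding tree_rep.simps sem.simps and_lang_eq by (intro represents_and represents_lists) auto
next
  case (Leaf \<gamma>)
  then show ?case using represents_leaf by simp
qed (simp_all add: represents_eps represents_lists represents_diff del: set_map)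

lemma has_level_lists:
  assumes "\<forall>r\<in>set rs. has_level (Suc l) r"
  shows "has_level (Suc l) (or_list rs)" and "has_level (Suc l) (conc_list rs)"
    and "has_level (Suc l) (prefix_list rs)"
  using assms
  by (induction rs)
    (simp_all add: or_list_def conc_list_def prefix_list_def has_level_empty has_level_eps
      has_level_all has_level_or has_level_conc has_level_and)

lemma has_level_tree: "wf_adt \<theta> \<Longrightarrow> cd \<theta> \<le> k \<Longrightarrow> has_level (Suc k) (tree_rep \<theta>)"
proof (induction \<theta> arbitrary: k)
  case (C t u)
  \<comment> \<open>A countermeasure has depth at least 1, so \<open>k\<close> is positive and the
    subtrahend has depth at most \<open>k'\<close>.\<close>
  then obtain k' where "k = Suc k'" by (cases k) auto
  with C show ?case by (simp add: has_level_diff)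
next
  case (OR ts)
  then show ?case by (auto simp: list_all_iff intro!: has_level_lists)
next
  case (SAND ts)
  then show ?case by (auto simp: list_all_iff intro!: has_level_lists)
next
  case (AND ts)
  then show ?case by (auto simp: list_all_iff intro!: has_level_lists has_level_and)
qed (simp_all add: has_level_eps has_level_leaf)

subsection \<open>Sentences\<close>

text \<open>False on every nonempty word and of truth value \<open>e\<close> on the empty word: a
  disjunct that only settles the empty word. \<open>nonempty_sentence\<close> is the corresponding
  conjunct, true on every nonempty word.\<close>

definition eps_sentence :: "bool \<Rightarrow> 'p fo" where
  "eps_sentence e = (if e then Uni 3 (Less 3 3) else Exi 3 (Less 3 3))"

definition nonempty_sentence :: "bool \<Rightarrow> 'p fo" where
  "nonempty_sentence e = (if e then Uni 3 (Neg (Less 3 3)) else Exi 3 (Neg (Less 3 3)))"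

definition sigma_sentence :: "'p rep \<Rightarrow> 'p fo" where
  "sigma_sentence r =
     Disj (eps_sentence (fst r)) (Exi 3 (Conj (Uni 4 (Neg (Less 3 4))) (snd r True True)))"

definition pi_sentence :: "'p rep \<Rightarrow> 'p fo" where
  "pi_sentence r =
     Conj (nonempty_sentence (fst r)) (Uni 3 (Disj (Exi 4 (Less 3 4)) (snd r True True)))"

text \<open>The last position is the only one with none after it, and the prefix ending there is the
  whole word.\<close>

lemma sat_last_position:
  assumes "represents r L" and "w \<noteq> []"
  shows "(\<forall>j<length w. \<not> i < j) \<and> i < length w \<longleftrightarrow> i = length w - 1"
    and "sat w ((\<lambda>_. 0)(3 := length w - 1)) (snd r True True) \<longleftrightarrow> w \<in> L"
proof -
  show "(\<forall>j<length w. \<not> i < j) \<and> i < length w \<longleftrightarrow> i = length w - 1"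
    using assms(2) by (cases w) (auto simp: not_less less_Suc_eq_le)
  show "sat w ((\<lambda>_. 0)(3 := length w - 1)) (snd r True True) \<longleftrightarrow> w \<in> L"
    using assms by (simp add: represents_def factor_def)
qed

lemma lang_sigma_sentence:
  assumes r: "represents r L"
  shows "lang (sigma_sentence r) = L"
proof -
  have "sat w (\<lambda>_. 0) (sigma_sentence r) \<longleftrightarrow> w \<in> L" for w
  proof (cases "w = []")
    case True
    with r show ?thesis by (auto simp: sigma_sentence_def eps_sentence_def represents_def)
  next
    case False
    then have "\<exists>i. i < length w" by blast
    then have "\<not> sat w (\<lambda>_. 0) (eps_sentence (fst r))" by (simp add: eps_sentence_def)
    then have "sat w (\<lambda>_. 0) (sigma_sentence r) \<longleftrightarrow>
        (\<exists>i. ((\<forall>j<length w. \<not> i < j) \<and> i < length w) \<and> sat w ((\<lambda>_. 0)(3 := i)) (snd r True True))"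
      by (auto simp: sigma_sentence_def)
    then show ?thesis
      unfolding sat_last_position(1)[OF r False] by (simp add: sat_last_position(2)[OF r False, simplified])
  qed
  then show ?thesis by (simp add: lang_def)
qed

lemma lang_pi_sentence:
  assumes r: "represents r L"
  shows "lang (pi_sentence r) = L"
proof -
  have "sat w (\<lambda>_. 0) (pi_sentence r) \<longleftrightarrow> w \<in> L" for w
  proof (cases "w = []")
    case True
    with r show ?thesis by (auto simp: pi_sentence_def nonempty_sentence_def represents_def)
  next
    case False
    then have "\<exists>i. i < length w" by blast
    then have "sat w (\<lambda>_. 0) (nonempty_sentence (fst r))" by (simp add: nonempty_sentence_def)
    then have "sat w (\<lambda>_. 0) (pi_sentence r) \<longleftrightarrow>
        (\<forall>i. (\<forall>j<length w. \<not> i < j) \<and> i < length w \<longrightarrow> sat w ((\<lambda>_. 0)(3 := i)) (snd r True True))"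
      by (auto simp: pi_sentence_def)
    then show ?thesis
      unfolding sat_last_position(1)[OF r False] by (simp add: sat_last_position(2)[OF r False, simplified])
  qed
  then show ?thesis by (simp add: lang_def)
qed

text \<open>Both admissible values of \<open>l\<close> occur. At depth 0 the body has level 1, and
  the condition of being last raises the sentence to level 2; at depth \<open>k > 0\<close> the body
  already has level \<open>k + 1\<close>, which absorbs that condition.\<close>

lemma sigma_sentence_level:
  assumes "has_level l r" and "l \<le> Suc (Suc m)" "l \<ge> Suc m"
  shows "sigma_sentence r \<in> Sigma_sentences (Suc (Suc m))"
proof -
  have "Sigma_fo (Suc (Suc m)) (snd r True True)" "free_vars (snd r True True) \<subseteq> {3}"
    using has_levelD[OF assms(1), of True True] assms(2,3)
    by (auto simp: sigma_pi_def le_Suc_eq intro: Sigma_from_Sigma)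
  moreover have "Pi_fo (Suc m) (Uni 4 (Neg (Less 3 4)))" "Pi_fo (Suc m) (Uni 3 (Less 3 3))"
      "Sigma_fo (Suc m) (Exi 3 (Less 3 3))" for m
    by (intro Sigma_Exi Pi_Uni Sigma_quantifier_free Pi_quantifier_free; simp)+
  ultimately show ?thesis
    by (auto simp: Sigma_sentences_def sentence_def sigma_sentence_def eps_sentence_def
        intro!: Sigma_Disj Sigma_Conj intro: Sigma_Exi Sigma_from_Pi Sigma_from_Sigma)
qed

text \<open>Not being last is a \<open>\<Sigma>\<close> condition of level 1, as is the body; both
  are thus \<open>\<Pi>\<close> formulas of level 2, a class closed under disjunction and the
  universal quantifier.\<close>

lemma pi_sentence_level:
  assumes "has_level 1 r"
  shows "pi_sentence r \<in> Pi_sentences 2"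
proof -
  have "Sigma_fo 1 (snd r True True)" "free_vars (snd r True True) \<subseteq> {3}"
    using has_levelD[OF assms, of True True] by (auto simp: sigma_pi_def)
  moreover have "Sigma_fo (Suc 0) (Exi 4 (Less 3 4))" "Pi_fo (Suc 0) (Uni 3 (Neg (Less 3 3)))"
      "Sigma_fo (Suc 0) (Exi 3 (Neg (Less 3 3)))"
    by (intro Sigma_Exi Pi_Uni Sigma_quantifier_free Pi_quantifier_free; simp)+
  ultimately show ?thesis
    by (auto simp: Pi_sentences_def sentence_def pi_sentence_def nonempty_sentence_def numeral_2_eq_2
        intro!: Pi_Disj Pi_Conj intro: Pi_Uni Pi_from_Sigma Pi_from_Pi)
qed


section \<open>Computability of the translation\<close>

lemma computable_if_const [computable_intros]:
  "(c \<Longrightarrow> computable f) \<Longrightarrow> (\<not> c \<Longrightarrow> computable g) \<Longrightarrow> computable (\<lambda>x. if c then f x else g x)"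
  by (cases c) simp_all

section \<open>Syntax operations on codes\<close>

definition less_code :: "nat \<Rightarrow> nat \<Rightarrow> nat" where
  "less_code x y = pair 1 (pair x y)"

definition lit_code :: "bool \<Rightarrow> nat \<Rightarrow> nat" where
  "lit_code b c = (if b then c else pair 2 c)"

definition conj_code :: "bool \<Rightarrow> nat \<Rightarrow> nat \<Rightarrow> nat" where
  "conj_code b c d = pair (if b then 3 else 4) (pair c d)"

definition ex_code :: "bool \<Rightarrow> nat \<Rightarrow> nat \<Rightarrow> nat" where
  "ex_code b x c = pair (if b then 5 else 6) (pair x c)"

definition truth_code :: "bool \<Rightarrow> nat" where
  "truth_code e = lit_code (\<not> e) (less_code 3 3)"

definition subst_code :: "bool \<Rightarrow> nat \<Rightarrow> nat \<Rightarrow> nat \<Rightarrow> nat" where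
  "subst_code b x y c = ex_code b x (conj_code b
     (lit_code b (conj_code True (lit_code False (less_code x y)) (lit_code False (less_code y x)))) c)"

lemma code_fo_simps:
  "code_fo (Less x y) = less_code x y"
  "code_fo (Neg \<phi>) = lit_code False (code_fo \<phi>)"
  "code_fo (Conj \<phi> \<psi>) = conj_code True (code_fo \<phi>) (code_fo \<psi>)"
  "code_fo (Disj \<phi> \<psi>) = conj_code False (code_fo \<phi>) (code_fo \<psi>)"
  "code_fo (Exi x \<phi>) = ex_code True x (code_fo \<phi>)"
  "code_fo (Uni x \<phi>) = ex_code False x (code_fo \<phi>)"
  "code_fo (lit b \<phi>) = lit_code b (code_fo \<phi>)"
  "code_fo (conj_fo b \<phi> \<psi>) = conj_code b (code_fo \<phi>) (code_fo \<psi>)"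
  "code_fo (ex_fo b x \<phi>) = ex_code b x (code_fo \<phi>)"
  "code_fo (truth e) = truth_code e"
  "code_fo (subst_fo b x y \<phi>) = subst_code b x y (code_fo \<phi>)"
  by (simp_all add: less_code_def lit_code_def conj_code_def ex_code_def truth_code_def
      subst_code_def lit_def conj_fo_def ex_fo_def truth_def subst_fo_def)

declare code_fo.simps(2-7) [simp del]
declare code_fo_simps [simp]

lemma computable_lit_code [computable_intros]:
  "computable c \<Longrightarrow> computable (\<lambda>x. lit_code b (c x))"
  unfolding lit_code_def by (intro computable_intros)

lemma computable_conj_code [computable_intros]:
  "computable c \<Longrightarrow> computable d \<Longrightarrow> computable (\<lambda>x. conj_code b (c x) (d x))"
  unfolding conj_code_def by (intro computable_intros)

lemma computable_ex_code [computable_intros]: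
  "computable c \<Longrightarrow> computable (\<lambda>x. ex_code b y (c x))"
  unfolding ex_code_def by (intro computable_intros)

lemma computable_subst_code [computable_intros]:
  "computable c \<Longrightarrow> computable (\<lambda>x. subst_code b y z (c x))"
  unfolding subst_code_def by (intro computable_intros)

text \<open>A representation amounts to one bit and four formulas, because both flags are Boolean,
  and so fits into a single number.\<close>

definition mk_rep_code :: "nat \<Rightarrow> (bool \<Rightarrow> bool \<Rightarrow> nat) \<Rightarrow> nat" where
  "mk_rep_code e f = pair e (pair (pair (f True True) (f True False))
     (pair (f False True) (f False False)))"

definition fo_part :: "bool \<Rightarrow> bool \<Rightarrow> nat \<Rightarrow> nat" where
  "fo_part b s c = (if s then pfst else psnd) ((if b then pfst else psnd) (psnd c))"

lemma mk_rep_code_parts [simp]: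
  "pfst (mk_rep_code e f) = e" "fo_part b s (mk_rep_code e f) = f b s"
  by (cases b; cases s; simp add: mk_rep_code_def fo_part_def)+

lemma mk_rep_code_cong: "e = e' \<Longrightarrow> (\<And>b s. f b s = f' b s) \<Longrightarrow> mk_rep_code e f = mk_rep_code e' f'"
  by (simp add: mk_rep_code_def)

lemma computable_mk_rep_code [computable_intros]:
  "computable e \<Longrightarrow> (\<And>b s. computable (\<lambda>x. f x b s)) \<Longrightarrow> computable (\<lambda>x. mk_rep_code (e x) (f x))"
  unfolding mk_rep_code_def by (intro computable_intros)

lemma computable_fo_part [computable_intros]:
  "computable c \<Longrightarrow> computable (\<lambda>x. fo_part b s (c x))"
  unfolding fo_part_def by (cases b; cases s; simp; intro computable_intros)

definition rep_code :: "'p::finite rep \<Rightarrow> nat" where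
  "rep_code r = mk_rep_code (of_bool (fst r)) (\<lambda>b s. code_fo (snd r b s))"

definition all_code :: nat where
  "all_code = mk_rep_code 1 (\<lambda>b s. truth_code b)"

definition empty_code :: nat where
  "empty_code = mk_rep_code 0 (\<lambda>b s. truth_code (\<not> b))"

definition eps_code :: nat where
  "eps_code = mk_rep_code 1 (\<lambda>b s. if s then truth_code (\<not> b) else lit_code (\<not> b) (less_code 2 3))"

definition leaf_code :: "nat \<Rightarrow> nat" where
  "leaf_code c = mk_rep_code 0 (\<lambda>b s. lit_code b (if s then c else conj_code True (less_code 2 3) c))"

definition or_code :: "nat \<Rightarrow> nat \<Rightarrow> nat" where
  "or_code c d = mk_rep_code (if pfst c = 0 then pfst d else 1)
     (\<lambda>b s. conj_code (\<not> b) (fo_part b s c) (fo_part b s d))"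

definition and_code :: "nat \<Rightarrow> nat \<Rightarrow> nat" where
  "and_code c d = mk_rep_code (if pfst c = 0 then 0 else pfst d)
     (\<lambda>b s. conj_code b (fo_part b s c) (fo_part b s d))"

definition diff_code :: "nat \<Rightarrow> nat \<Rightarrow> nat" where
  "diff_code c d = mk_rep_code (if pfst d = 0 then pfst c else 0)
     (\<lambda>b s. conj_code b (fo_part b s c) (fo_part (\<not> b) s d))"

text \<open>The Boolean \<open>b = fst r\<close> inside \<open>conc_rep\<close> depends on the
  input, so the code chooses between two constant formulas by a test on the bit.\<close>

definition conc_code :: "nat \<Rightarrow> nat \<Rightarrow> nat" where
  "conc_code c d = mk_rep_code (if pfst c = 0 then 0 else pfst d) (\<lambda>b s.
     conj_code (\<not> b)
       (conj_code b (if pfst c = 0 then truth_code (\<not> b) else truth_code b) (fo_part b s d))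
       (ex_code b 4 (conj_code b
         (lit_code b (conj_code True (lit_code False (less_code 4 (if s then 4 else 2)))
            (lit_code False (less_code 3 4))))
         (conj_code b (subst_code b 3 4 (fo_part b s c)) (subst_code b 2 4 (fo_part b False d))))))"

lemma rep_code_simps:
  "rep_code all_rep = all_code"
  "rep_code empty_rep = empty_code"
  "rep_code eps_rep = eps_code"
  "rep_code (leaf_rep \<phi>) = leaf_code (code_fo \<phi>)"
  "rep_code (or_rep r r') = or_code (rep_code r) (rep_code r')"
  "rep_code (and_rep r r') = and_code (rep_code r) (rep_code r')"
  "rep_code (diff_rep r r') = diff_code (rep_code r) (rep_code r')"
  "rep_code (conc_rep r r') = conc_code (rep_code r) (rep_code r')"
  unfolding rep_code_def all_code_def empty_code_def eps_code_def leaf_code_def or_code_def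
    and_code_def diff_code_def conc_code_def
  by (rule mk_rep_code_cong;
      auto simp: all_rep_def empty_rep_def eps_rep_def leaf_rep_def or_rep_def and_rep_def
        diff_rep_def conc_rep_def)+

lemma computable_leaf_code [computable_intros]:
  "computable c \<Longrightarrow> computable (\<lambda>x. leaf_code (c x))"
  unfolding leaf_code_def by (intro computable_intros)

lemma computable_or_code [computable_intros]:
  "computable c \<Longrightarrow> computable d \<Longrightarrow> computable (\<lambda>x. or_code (c x) (d x))"
  unfolding or_code_def by (intro computable_intros)

lemma computable_and_code [computable_intros]:
  "computable c \<Longrightarrow> computable d \<Longrightarrow> computable (\<lambda>x. and_code (c x) (d x))"
  unfolding and_code_def by (intro computable_intros)

lemma computable_diff_code [computable_intros]:
  "computable c \<Longrightarrow> computable d \<Longrightarrow> computable (\<lambda>x. diff_code (c x) (d x))"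
  unfolding diff_code_def by (intro computable_intros)

lemma computable_conc_code [computable_intros]:
  "computable c \<Longrightarrow> computable d \<Longrightarrow> computable (\<lambda>x. conc_code (c x) (d x))"
  unfolding conc_code_def by (intro computable_intros)

section \<open>Recursion on codes of propositional formulas and trees\<close>

definition pform_step :: "(nat \<Rightarrow> nat) \<Rightarrow> nat \<Rightarrow> nat \<Rightarrow> nat" where
  "pform_step atom n h =
     (if pfst n = 0 then atom (psnd n)
      else if pfst n = 1 then lit_code False (recall n h (psnd n))
      else if pfst n = 2
      then conj_code True (recall n h (pfst (psnd n))) (recall n h (psnd (psnd n)))
      else conj_code False (recall n h (pfst (psnd n))) (recall n h (psnd (psnd n))))"

lemma pair_bounds: "k \<noteq> 0 \<Longrightarrow> x < pair k x"
  "k \<noteq> 0 \<Longrightarrow> x < pair k (pair x y)" "k \<noteq> 0 \<Longrightarrow> y < pair k (pair x y)"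
proof -
  show *: "k \<noteq> 0 \<Longrightarrow> x < pair k x" for k x
    using psnd_less[of "pair k x"] by simp
  show "k \<noteq> 0 \<Longrightarrow> x < pair k (pair x y)" "k \<noteq> 0 \<Longrightarrow> y < pair k (pair x y)"
    using *[of k "pair x y"] le_prod_encode_1[of x y] le_prod_encode_2[of y x] by simp_all
qed

lemma computable_pform_fo:
  "\<exists>f. computable f \<and> (\<forall>\<gamma> :: 'p::finite pform. f (code_pform \<gamma>) = code_fo (pform_fo \<gamma>))"
proof -
  obtain N where N: "to_nat p < N" for p :: 'p
  proof -
    have "finite (range (to_nat :: 'p \<Rightarrow> nat))" by simp
    then show ?thesis using that unfolding finite_nat_set_iff_bounded by blast
  qed
  \<comment> \<open>As there are finitely many propositions, the atoms form a finite table bounded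
    by \<open>N\<close>, so the choice made by \<open>SOME\<close> does not harm computability.
    Entries at numbers that code no proposition are arbitrary.\<close>
  define atom where
    "atom x = (if x < N then code_fo (pform_fo (PAtom (from_nat x :: 'p))) else 0)" for x
  have atom: "computable (\<lambda>x. atom (g x))" if "computable g" for g
    unfolding atom_def by (rule computable_comp[OF computable_finite_table that])
  define f where "f = cov_rec (pform_step atom)"
  have "computable f"
    unfolding f_def pform_step_def by (intro computable_cov_rec computable_intros atom)
  moreover have "f (pair 0 x) = atom x" "f (pair 1 x) = lit_code False (f x)"
      "f (pair 2 (pair x y)) = conj_code True (f x) (f y)"
      "f (pair 3 (pair x y)) = conj_code False (f x) (f y)" for x y
    unfolding f_def by (subst cov_rec_def, simp add: pform_step_def recall_history pair_bounds)+
  then have "f (code_pform \<gamma>) = code_fo (pform_fo \<gamma>)" for \<gamma> :: "'p pform"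
  proof (induction \<gamma>)
    case (PAtom p)
    then show ?case using N[of p] by (simp add: atom_def)
  qed simp_all
  ultimately show ?thesis by blast
qed

text \<open>Every number is decoded both as a tree and as a list of trees; the value consists of the
  representation of the tree and the results of folding the three list operations over the
  list.\<close>

definition tree_part :: "nat \<Rightarrow> nat" where "tree_part c = pfst (pfst c)"
definition or_part :: "nat \<Rightarrow> nat" where "or_part c = psnd (pfst c)"
definition conc_part :: "nat \<Rightarrow> nat" where "conc_part c = pfst (psnd c)"
definition prefix_part :: "nat \<Rightarrow> nat" where "prefix_part c = psnd (psnd c)"

definition tree_step :: "(nat \<Rightarrow> nat) \<Rightarrow> nat \<Rightarrow> nat \<Rightarrow> nat" where
  "tree_step leaf n h =
     (if pfst n = 0 then eps_code
      else if pfst n = 1 then leaf_code (leaf (psnd n))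
      else if pfst n = 2 then or_part (recall n h (psnd n))
      else if pfst n = 3 then conc_part (recall n h (psnd n))
      else if pfst n = 4
      then and_code (or_part (recall n h (psnd n))) (prefix_part (recall n h (psnd n)))
      else diff_code (tree_part (recall n h (pfst (psnd n)))) (tree_part (recall n h (psnd (psnd n)))))"

text \<open>\<open>list_encode\<close> maps a nonempty list to the successor of the pair of its head
  and the code of its tail, hence the \<open>n - 1\<close>.\<close>

definition or_step :: "nat \<Rightarrow> nat \<Rightarrow> nat" where
  "or_step n h = (if n = 0 then empty_code else
     or_code (tree_part (recall n h (pfst (n - 1)))) (or_part (recall n h (psnd (n - 1)))))"

definition conc_step :: "nat \<Rightarrow> nat \<Rightarrow> nat" where
  "conc_step n h = (if n = 0 then eps_code else
     conc_code (tree_part (recall n h (pfst (n - 1)))) (conc_part (recall n h (psnd (n - 1)))))"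

definition prefix_step :: "nat \<Rightarrow> nat \<Rightarrow> nat" where
  "prefix_step n h = (if n = 0 then all_code else
     and_code (conc_code (tree_part (recall n h (pfst (n - 1)))) all_code)
       (prefix_part (recall n h (psnd (n - 1)))))"

definition adt_step :: "(nat \<Rightarrow> nat) \<Rightarrow> nat \<Rightarrow> nat \<Rightarrow> nat" where
  "adt_step leaf n h =
     pair (pair (tree_step leaf n h) (or_step n h)) (pair (conc_step n h) (prefix_step n h))"

lemma computable_parts [computable_intros]:
  assumes "computable c"
  shows "computable (\<lambda>x. tree_part (c x))" "computable (\<lambda>x. or_part (c x))"
    "computable (\<lambda>x. conc_part (c x))" "computable (\<lambda>x. prefix_part (c x))"
  unfolding tree_part_def or_part_def conc_part_def prefix_part_def
  by (intro computable_intros assms)+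

lemma computable_adt_step:
  assumes "computable leaf"
  shows "computable (\<lambda>p. adt_step leaf (pfst p) (psnd p))"
  unfolding adt_step_def tree_step_def or_step_def conc_step_def prefix_step_def
  by (intro computable_intros computable_comp[OF assms])

lemma cov_rec_adt_step:
  fixes leaf defines "V \<equiv> cov_rec (adt_step leaf)"
  shows "tree_part (V (pair 0 x)) = eps_code"
    and "tree_part (V (pair 1 x)) = leaf_code (leaf x)"
    and "tree_part (V (pair 2 x)) = or_part (V x)"
    and "tree_part (V (pair 3 x)) = conc_part (V x)"
    and "tree_part (V (pair 4 x)) = and_code (or_part (V x)) (prefix_part (V x))"
    and "tree_part (V (pair 5 (pair x y))) = diff_code (tree_part (V x)) (tree_part (V y))"
    and "or_part (V 0) = empty_code"
    and "or_part (V (Suc (pair x y))) = or_code (tree_part (V x)) (or_part (V y))"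
    and "conc_part (V 0) = eps_code"
    and "conc_part (V (Suc (pair x y))) = conc_code (tree_part (V x)) (conc_part (V y))"
    and "prefix_part (V 0) = all_code"
    and "prefix_part (V (Suc (pair x y)))
      = and_code (conc_code (tree_part (V x)) all_code) (prefix_part (V y))"
proof -
  let ?h = "history (adt_step leaf)"
  have parts: "tree_part (V n) = tree_step leaf n (?h n)" "or_part (V n) = or_step n (?h n)"
    "conc_part (V n) = conc_step n (?h n)" "prefix_part (V n) = prefix_step n (?h n)" for n
    by (simp_all add: V_def cov_rec_def adt_step_def tree_part_def or_part_def conc_part_def
        prefix_part_def)
  have recall: "m < n \<Longrightarrow> recall n (?h n) m = V m" for m n
    by (simp add: V_def recall_history)
  \<comment> \<open>The pairing gives only weak bounds; the successor in the list code supplies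
    strictness.\<close>
  have less: "x < Suc (pair x y)" "y < Suc (pair x y)" for x y
    by (simp_all add: less_Suc_eq_le le_prod_encode_1 le_prod_encode_2)
  show "tree_part (V (pair 0 x)) = eps_code"
    "tree_part (V (pair 1 x)) = leaf_code (leaf x)"
    "tree_part (V (pair 2 x)) = or_part (V x)"
    "tree_part (V (pair 3 x)) = conc_part (V x)"
    "tree_part (V (pair 4 x)) = and_code (or_part (V x)) (prefix_part (V x))"
    "tree_part (V (pair 5 (pair x y))) = diff_code (tree_part (V x)) (tree_part (V y))"
    \<comment> \<open>A single unfolding, so that the recalled values at the components stay
      folded.\<close>
    by (subst parts(1), simp add: tree_step_def recall pair_bounds)+
  show "or_part (V 0) = empty_code" "conc_part (V 0) = eps_code" "prefix_part (V 0) = all_code"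
    by (simp_all add: parts or_step_def conc_step_def prefix_step_def)
  show "or_part (V (Suc (pair x y))) = or_code (tree_part (V x)) (or_part (V y))"
    by (subst parts(2)) (simp add: or_step_def recall less del: history.simps)
  show "conc_part (V (Suc (pair x y))) = conc_code (tree_part (V x)) (conc_part (V y))"
    by (subst parts(3)) (simp add: conc_step_def recall less del: history.simps)
  show "prefix_part (V (Suc (pair x y)))
      = and_code (conc_code (tree_part (V x)) all_code) (prefix_part (V y))"
    by (subst parts(4)) (simp add: prefix_step_def recall less del: history.simps)
qed

lemma cov_rec_adt_step_list:
  fixes leaf defines "V \<equiv> cov_rec (adt_step leaf)"
  assumes "\<forall>t\<in>set ts. tree_part (V (code_adt t)) = rep_code (tree_rep t)"
  shows "or_part (V (list_encode (map code_adt ts))) = rep_code (or_list (map tree_rep ts))"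
    and "conc_part (V (list_encode (map code_adt ts))) = rep_code (conc_list (map tree_rep ts))"
    and "prefix_part (V (list_encode (map code_adt ts))) = rep_code (prefix_list (map tree_rep ts))"
  using assms(2)
  by (induction ts)
    (simp_all add: V_def cov_rec_adt_step or_list_def conc_list_def prefix_list_def rep_code_simps)

lemma computable_tree_rep:
  "\<exists>f. computable f \<and> (\<forall>\<theta> :: 'p::finite adt. f (code_adt \<theta>) = rep_code (tree_rep \<theta>))"
proof -
  obtain leaf where leaf: "computable leaf"
      "\<And>\<gamma> :: 'p pform. leaf (code_pform \<gamma>) = code_fo (pform_fo \<gamma>)"
    using computable_pform_fo by blast
  let ?V = "cov_rec (adt_step leaf)"
  have "computable (\<lambda>n. tree_part (?V n))"
    by (intro computable_intros computable_cov_rec computable_adt_step leaf)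
  moreover have "tree_part (?V (code_adt \<theta>)) = rep_code (tree_rep \<theta>)" for \<theta> :: "'p adt"
    by (induction \<theta>)
      (simp_all add: cov_rec_adt_step cov_rec_adt_step_list rep_code_simps leaf(2) del: One_nat_def)
  ultimately show ?thesis by blast
qed

section \<open>Effectiveness of the two sentence maps\<close>

lemma effective_tree_rep:
  fixes F :: "'p::finite rep \<Rightarrow> 'p fo"
  assumes "computable g" and "\<And>r. g (rep_code r) = code_fo (F r)"
  shows "effective (\<lambda>\<theta>. F (tree_rep \<theta>))"
proof -
  obtain f where f: "computable f" "\<And>\<theta> :: 'p adt. f (code_adt \<theta>) = rep_code (tree_rep \<theta>)"
    using computable_tree_rep by blast
  have "total_recursive 1 (\<lambda>xs. g (f (xs ! 0)))"
    using computable_comp[OF assms(1) f(1)] by (simp add: computable_def)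
  then obtain h where "recursive 1 h" "\<And>xs. length xs = 1 \<Longrightarrow> h xs = g (f (xs ! 0))"
    unfolding total_recursive_def by blast
  then show ?thesis
    unfolding effective_def by (intro exI[of _ h]) (simp add: f assms(2))
qed

lemma effective_sigma_sentence: "effective (\<lambda>\<theta> :: 'p::finite adt. sigma_sentence (tree_rep \<theta>))"
proof (rule effective_tree_rep)
  let ?g = "\<lambda>c. conj_code False
    (if pfst c = 0 then ex_code True 3 (less_code 3 3) else ex_code False 3 (less_code 3 3))
    (ex_code True 3 (conj_code True (ex_code False 4 (lit_code False (less_code 3 4)))
      (fo_part True True c)))"
  show "computable ?g" by (intro computable_intros)
  show "?g (rep_code r) = code_fo (sigma_sentence r)" for r :: "'p rep"
    by (simp add: rep_code_def sigma_sentence_def eps_sentence_def)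
qed

lemma effective_pi_sentence: "effective (\<lambda>\<theta> :: 'p::finite adt. pi_sentence (tree_rep \<theta>))"
proof (rule effective_tree_rep)
  let ?g = "\<lambda>c. conj_code True
    (if pfst c = 0 then ex_code True 3 (lit_code False (less_code 3 3))
     else ex_code False 3 (lit_code False (less_code 3 3)))
    (ex_code False 3 (conj_code False (ex_code True 4 (less_code 3 4)) (fo_part True True c)))"
  show "computable ?g" by (intro computable_intros)
  show "?g (rep_code r) = code_fo (pi_sentence r)" for r :: "'p rep"
    by (simp add: rep_code_def pi_sentence_def nonempty_sentence_def)
qed

theorem lemma2:
  shows "((ADT_langs 0 :: 'p::finite trace set set) \<subseteq> Sigma_langs 2 \<inter> Pi_langs 2 \<and>
          (\<exists>F :: 'p adt \<Rightarrow> 'p fo. effective F \<and>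
             (\<forall>\<theta>\<in>ADT 0. F \<theta> \<in> Sigma_sentences 2 \<and> lang (F \<theta>) = sem \<theta>)) \<and>
          (\<exists>G :: 'p adt \<Rightarrow> 'p fo. effective G \<and>
             (\<forall>\<theta>\<in>ADT 0. G \<theta> \<in> Pi_sentences 2 \<and> lang (G \<theta>) = sem \<theta>)))
       \<and> ((\<forall>k>0. (ADT_langs k :: 'p trace set set) \<subseteq> Sigma_langs (k + 1)) \<and>
          (\<exists>H :: 'p adt \<Rightarrow> 'p fo. effective H \<and>
             (\<forall>k>0. \<forall>\<theta>\<in>ADT k. H \<theta> \<in> Sigma_sentences (k + 1) \<and> lang (H \<theta>) = sem \<theta>)))"
proof -
  \<comment> \<open>One map serves depth 0 and every positive depth: only the level bound depends on
    \<open>k\<close>, so a single computable function works uniformly.\<close>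
  let ?F = "\<lambda>\<theta> :: 'p adt. sigma_sentence (tree_rep \<theta>)"
  let ?G = "\<lambda>\<theta> :: 'p adt. pi_sentence (tree_rep \<theta>)"
  have level: "has_level (Suc k) (tree_rep \<theta>)" if "\<theta> \<in> ADT k" for k and \<theta> :: "'p adt"
    using that by (simp add: ADT_def has_level_tree)
  have langs: "lang (?F \<theta>) = sem \<theta>" "lang (?G \<theta>) = sem \<theta>" for \<theta>
    by (simp_all add: lang_sigma_sentence lang_pi_sentence represents_tree)
  have F0: "?F \<theta> \<in> Sigma_sentences 2" if "\<theta> \<in> ADT 0" for \<theta>
    using sigma_sentence_level[OF level[OF that], of 0] by (simp add: numeral_2_eq_2)
  have G0: "?G \<theta> \<in> Pi_sentences 2" if "\<theta> \<in> ADT 0" for \<theta>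
    using pi_sentence_level level[OF that] by simp
  have Fk: "?F \<theta> \<in> Sigma_sentences (k + 1)" if "0 < k" "\<theta> \<in> ADT k" for k \<theta>
    using sigma_sentence_level[OF level[OF that(2)], of "k - 1"] that(1) by simp
  have "ADT_langs 0 \<subseteq> (Sigma_langs 2 \<inter> Pi_langs 2 :: 'p trace set set)"
    unfolding ADT_langs_def Sigma_langs_def Pi_langs_def using langs F0 G0 by blast
  moreover have "(ADT_langs k :: 'p trace set set) \<subseteq> Sigma_langs (k + 1)" if "0 < k" for k
    unfolding ADT_langs_def Sigma_langs_def using langs(1) Fk[OF that] by blast
  ultimately show ?thesis
    using effective_sigma_sentence effective_pi_sentence langs F0 G0 Fk by blast
qed

end
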